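(* Let $q$ be a complex number with $|q|<1$. Then \[ f_3(q)=\frac{1}{(q;q)_\infty}-4\sum_{n=1}^\infty\frac{q^{2n}}{(q^{2n};q^2)_{n+1}(q^{2n+1};q)_\infty}, \] where $f_3(q)=\sum_{n=0}^\infty\frac{q^{n^2}}{(-q;q)_n^2}$ is Ramanujan's third order mock theta function.
   Context: For $N\ge 1$, $(A;q)_N=(1-A)(1-Aq)\cdots(1-Aq^{N-1})$, $(A;q)_0=1$, and $(A;q)_\infty=\lim_{N\to\infty}(A;q)_N$. *)

theory Defs
  imports Complex_Main
begin

definition qpoch :: "complex \<Rightarrow> complex \<Rightarrow> nat \<Rightarrow> complex" where
  "qpoch a q n = (\<Prod>k<n. 1 - a * q ^ k)"

definition qpoch_inf :: "complex \<Rightarrow> complex \<Rightarrow> complex" where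
  "qpoch_inf a q = lim (\<lambda>n. qpoch a q n)"

text \<open>The convention \<open>0 ^ 0 = 1\<close> makes the term \<open>n = 0\<close> equal to 1 also at \<open>q = 0\<close>.\<close>

definition mock_theta_f3 :: "complex \<Rightarrow> complex" where
  "mock_theta_f3 q = (\<Sum>n. q ^ (n\<^sup>2) / (qpoch (- q) q n)\<^sup>2)"

end

theory Submission
  imports Defs "HOL-Analysis.Analysis"
begin

text \<open>
  Put \<open>p = q\<^sup>2\<close>, \<open>x = - q\<close>, and let \<open>F\<close>, \<open>E\<close>, \<open>P\<close>, \<open>\<Theta>\<close>, \<open>G\<close>, \<open>L\<close>, \<open>\<Phi>\<close> be the sums of
  \<open>F_term\<close>, \<open>E_term\<close>, \<open>P_term\<close>, \<open>partial_theta_term\<close>, \<open>G_term\<close>, \<open>Lambert_term\<close>, \<open>Phi_term\<close>.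
  Every series involved satisfies a first order functional equation under \<open>x \<mapsto> x p\<close> (or \<open>t \<mapsto> t q\<close>), obtained by telescoping, and two solutions that agree near 0 coincide.
  In this way \<open>f\<^sub>3(q) = 2 - F(- q)\<close> with \<open>F(t) = \<Sum> t\<^sup>n / (-q;q)\<^sub>n\<close>; pairing consecutive terms gives
  \<open>F(- q) = 1 / (-q;q)\<^sub>\<infinity> + 2 E\<close>, the series \<open>P - E\<close> is a multiple of a partial theta series \<open>\<Theta>\<close>, and
  the series on the right-hand side, \<open>G / (q;q)\<^sub>\<infinity>\<close>, satisfies
  \<open>G = L - (p;p)\<^sub>\<infinity> / (2 (-q;q)\<^sub>\<infinity>) \<Phi>\<close> with a Lambert series \<open>L\<close>.
  Three specialisations of Ramanujan's \<open>\<^sub>1\<psi>\<^sub>1\<close> summation evaluate \<open>2 \<Theta> - 1\<close>, \<open>P + \<Phi> - 1\<close> and \<open>4 L - 1\<close>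
  as infinite products, namely \<open>\<theta>\<close>, \<open>\<theta> / (-q;q)\<^sub>\<infinity>\<close> and \<open>\<theta>\<^sup>2\<close> for \<open>\<theta> = (q;q)\<^sub>\<infinity> / (-q;q)\<^sub>\<infinity>\<close>; the theorem is a linear
  combination of these relations.
\<close>

subsection \<open>Ratio-type series and q-Pochhammer symbols\<close>

text \<open>The ratios are eventually below some \<open>c\<close> with
  \<open>\<rho> < c < 1\<close>. Bounding by a product instead of a quotient admits terms that are
  zero.\<close>

lemma summable_ratio_limit:
  fixes a :: "nat \<Rightarrow> 'a::banach"
  assumes step: "\<And>k. norm (a (Suc k)) \<le> R k * norm (a k)" and R: "R \<longlonglongrightarrow> \<rho>" and "\<rho> < 1"
  shows "summable a"
proof -
  obtain c where c: "\<rho> < c" "c < 1" using \<open>\<rho> < 1\<close> dense by blast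
  have "eventually (\<lambda>k. R k < c) sequentially" using order_tendstoD(2)[OF R c(1)] .
  then obtain N where N: "\<And>k. k \<ge> N \<Longrightarrow> R k < c" unfolding eventually_sequentially by blast
  show ?thesis
  proof (rule summable_ratio_test[OF c(2)])
    fix k assume "N \<le> k"
    then have "R k * norm (a k) \<le> c * norm (a k)" using N[of k] by (intro mult_right_mono) auto
    with step[of k] show "norm (a (Suc k)) \<le> c * norm (a k)" by linarith
  qed
qed

text \<open>Tannery's theorem for series given by their term ratios. A bound on the initial terms
  times the products of the \<open>R j\<close> is a majorant independent of \<open>n\<close>,
  summable because \<open>R\<close> tends to \<open>\<rho> < 1\<close>; the termwise limits follow
  by induction on \<open>k\<close>.\<close>

lemma tannery_ratio:
  fixes a :: "nat \<Rightarrow> nat \<Rightarrow> complex"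
  assumes a0: "(\<lambda>n. a n 0) \<longlonglongrightarrow> b 0" and a: "\<And>n k. a n (Suc k) = r n k * a n k"
    and b: "\<And>k. b (Suc k) = s k * b k"
    and lim: "\<And>k. (\<lambda>n. r n k) \<longlonglongrightarrow> s k"
    and bd: "\<And>n k. norm (r n k) \<le> R k" and R: "R \<longlonglongrightarrow> \<rho>" and "\<rho> < 1"
  shows "(\<lambda>n. \<Sum>k. a n k) \<longlonglongrightarrow> (\<Sum>k. b k)"
proof -
  obtain C where C: "\<And>n. norm (a n 0) \<le> C" "C > 0"
    using convergent_imp_Bseq[OF convergentI[OF a0]] unfolding Bseq_def by blast
  define M where "M k = C * (\<Prod>j<k. R j)" for k
  have R0: "R k \<ge> 0" for k using bd[of 0 k] norm_ge_zero order_trans by blast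
  have M0: "M k \<ge> 0" for k unfolding M_def by (intro mult_nonneg_nonneg prod_nonneg) (use C(2) in \<open>auto simp: R0\<close>)
  have "summable M"
    by (rule summable_ratio_limit[OF _ R \<open>\<rho> < 1\<close>])
       (auto simp: M_def R0 abs_mult abs_prod mult_ac)
  moreover have "norm (a n k) \<le> M k" for n k
  proof (induction k)
    case (Suc k)
    have "norm (a n (Suc k)) \<le> R k * M k"
      unfolding a norm_mult by (intro mult_mono bd Suc R0 norm_ge_zero)
    then show ?case by (simp add: M_def mult_ac)
  qed (simp add: M_def C(1))
  moreover have "(\<lambda>n. a n k) \<longlonglongrightarrow> b k" for k
  proof (induction k)
    case (Suc k)
    show ?case unfolding a b by (intro tendsto_mult lim Suc)
  qed (rule a0)
  ultimately show ?thesis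
    using tannerys_theorem[of "\<lambda>k n. a n k" b sequentially M]
    by (auto intro!: always_eventually)
qed

section \<open>Sequences that a recurrence forces to vanish\<close>

text \<open>The limit equals its own negative, hence is 0, while the norm stays constant along the
  sequence. In the applications \<open>d n\<close> is the defect \<open>\<delta> (x * p ^ n)\<close>
  between two solutions of one functional equation.\<close>

lemma alternating_convergent_zero:
  fixes d :: "nat \<Rightarrow> complex"
  assumes d: "\<And>n. d n = - d (Suc n)" and l: "d \<longlonglongrightarrow> l"
  shows "d 0 = 0"
proof -
  have "(\<lambda>n. - d (Suc n)) \<longlonglongrightarrow> - l" by (intro tendsto_minus LIMSEQ_Suc l)
  then have "d \<longlonglongrightarrow> - l" by (simp flip: d)
  then have "l = - l" using l LIMSEQ_unique by blast
  then have "(\<lambda>n. norm (d n)) \<longlonglongrightarrow> 0" using tendsto_norm[OF l] by simp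
  moreover
  have "norm (d n) = norm (d 0)" for n
  proof (induction n)
    case (Suc n)
    then show ?case using arg_cong[OF d[of n], of norm] by simp
  qed simp
  then have "(\<lambda>n. norm (d n)) = (\<lambda>n. norm (d 0))" by blast
  ultimately show ?thesis by (simp add: LIMSEQ_const_iff)
qed

text \<open>Iteration bounds \<open>norm (d 0)\<close> by \<open>c ^ n * norm (d n)\<close>, which
  tends to 0 because \<open>d\<close> converges.\<close>

lemma contracting_convergent_zero:
  fixes d :: "nat \<Rightarrow> complex"
  assumes d: "\<And>n. norm (d n) \<le> c * norm (d (Suc n))" and c: "0 \<le> c" "c < 1" and l: "d \<longlonglongrightarrow> l"
  shows "d 0 = 0"
proof -
  have "norm (d 0) \<le> c ^ n * norm (d n)" for n
  proof (induction n)
    case (Suc n)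
    have "c ^ n * norm (d n) \<le> c ^ n * (c * norm (d (Suc n)))"
      using d[of n] c by (intro mult_left_mono) auto
    with Suc show ?case by (simp add: mult_ac)
  qed simp
  moreover have "(\<lambda>n. c ^ n * norm (d n)) \<longlonglongrightarrow> 0 * norm l"
    using c by (intro tendsto_mult LIMSEQ_realpow_zero tendsto_norm l)
  ultimately have "norm (d 0) \<le> 0" by (intro LIMSEQ_le_const) auto
  then show ?thesis by simp
qed

section \<open>Finite and infinite q-Pochhammer symbols\<close>

lemma qpoch_0 [simp]: "qpoch a q 0 = 1"
  by (simp add: qpoch_def)

lemma qpoch_Suc: "qpoch a q (Suc n) = qpoch a q n * (1 - a * q ^ n)"
  by (simp add: qpoch_def)

lemma qpoch_add: "qpoch a q (m + n) = qpoch a q m * qpoch (a * q ^ m) q n"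
  by (induction n) (simp_all add: qpoch_Suc power_add mult_ac)

text \<open>Both sides are \<open>qpoch a q (Suc n)\<close>, with the first or the last factor split
  off.\<close>

lemma qpoch_shift: "(1 - a) * qpoch (a * q) q n = qpoch a q n * (1 - a * q ^ n)"
  using qpoch_add[of a q 1 n] qpoch_Suc[of a q n] qpoch_Suc[of a q 0] by simp

lemma qpoch_split: "qpoch a q (2 * n) = qpoch a (q\<^sup>2) n * qpoch (a * q) (q\<^sup>2) n"
  by (induction n) (simp_all add: qpoch_Suc mult_ac flip: power_mult)

lemma qpoch_square: "qpoch a q n * qpoch (- a) q n = qpoch (a\<^sup>2) (q\<^sup>2) n"
  by (induction n) (simp_all add: qpoch_Suc algebra_simps power2_eq_square flip: power_mult_distrib)

lemma power_norm_le:
  fixes a q :: complex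
  assumes "norm q < 1"
  shows "norm (a * q ^ n) \<le> norm a"
  using assms by (simp add: norm_mult norm_power mult_left_le power_le_one)

lemma one_minus_nonzero:
  fixes z :: complex
  assumes "norm z < 1"
  shows "1 - z \<noteq> 0" "1 + z \<noteq> 0"
proof -
  show "1 - z \<noteq> 0" using assms by auto
  show "1 + z \<noteq> 0" using assms by (metis add_eq_0_iff norm_minus_cancel norm_one order_less_irrefl)
qed

context
  fixes q :: complex
  assumes q: "norm q < 1"
begin

lemma power_tendsto_0: "(\<lambda>n. a * q ^ n) \<longlonglongrightarrow> 0"
  using tendsto_mult[OF tendsto_const LIMSEQ_power_zero[OF q], of a] by simp

lemma qpoch_factor_nonzero:
  assumes "norm a < 1" shows "1 - a * q ^ n \<noteq> 0"
  using power_norm_le[OF q, of a n] assms by (intro one_minus_nonzero) linarith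

lemma qpoch_nonzero:
  assumes "norm a < 1" shows "qpoch a q n \<noteq> 0"
  by (induction n) (use qpoch_factor_nonzero[OF assms] in \<open>auto simp: qpoch_Suc\<close>)

lemma convergent_prod_qpoch: "convergent_prod (\<lambda>k. 1 - a * q ^ k)"
  using q by (intro abs_convergent_prod_imp_convergent_prod summable_imp_abs_convergent_prod)
    (simp add: norm_mult norm_power summable_mult summable_geometric)

lemma qpoch_tendsto: "qpoch a q \<longlonglongrightarrow> qpoch_inf a q"
proof -
  have "(\<lambda>n. \<Prod>k<Suc n. 1 - a * q ^ k) \<longlonglongrightarrow> (\<Prod>k. 1 - a * q ^ k)"
    using convergent_prod_LIMSEQ[OF convergent_prod_qpoch] by (simp add: lessThan_Suc_atMost)
  then have "qpoch a q \<longlonglongrightarrow> (\<Prod>k. 1 - a * q ^ k)"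
    unfolding qpoch_def by (subst (asm) filterlim_sequentially_Suc)
  then show ?thesis unfolding qpoch_inf_def by (simp add: limI)
qed

text \<open>A convergent product, in the strict sense of \<open>convergent_prod\<close>, is nonzero
  as soon as no factor vanishes, and \<open>norm a < 1\<close> excludes a vanishing factor.\<close>

lemma qpoch_inf_nonzero:
  assumes "norm a < 1" shows "qpoch_inf a q \<noteq> 0"
proof -
  have "(\<lambda>n. \<Prod>k<Suc n. 1 - a * q ^ k) \<longlonglongrightarrow> (\<Prod>k. 1 - a * q ^ k)"
    using convergent_prod_LIMSEQ[OF convergent_prod_qpoch] by (simp add: lessThan_Suc_atMost)
  moreover have "(\<lambda>n. \<Prod>k<Suc n. 1 - a * q ^ k) \<longlonglongrightarrow> qpoch_inf a q"
    using LIMSEQ_Suc[OF qpoch_tendsto] by (simp add: qpoch_def)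
  ultimately have "qpoch_inf a q = (\<Prod>k. 1 - a * q ^ k)" using LIMSEQ_unique by blast
  then show ?thesis
    using prodinf_nonzero[OF convergent_prod_qpoch qpoch_factor_nonzero[OF assms]] by simp
qed

lemma qpoch_inf_add: "qpoch_inf a q = qpoch a q m * qpoch_inf (a * q ^ m) q"
proof (rule LIMSEQ_unique)
  show "(\<lambda>n. qpoch a q (m + n)) \<longlonglongrightarrow> qpoch_inf a q"
    using LIMSEQ_ignore_initial_segment[OF qpoch_tendsto, of a m] by (simp add: add.commute)
  show "(\<lambda>n. qpoch a q (m + n)) \<longlonglongrightarrow> qpoch a q m * qpoch_inf (a * q ^ m) q"
    unfolding qpoch_add by (intro tendsto_intros qpoch_tendsto)
qed

lemma qpoch_inf_step: "qpoch_inf a q = (1 - a) * qpoch_inf (a * q) q"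
  using qpoch_inf_add[of a 1] by (simp add: qpoch_Suc)

lemma norm_square_less_1: "norm (q\<^sup>2) < 1"
  using q by (simp add: norm_power power_less_one_iff)

text \<open>The bound does not depend on \<open>n\<close>, as a majorant for
  \<open>tannery_ratio\<close> requires.\<close>

lemma norm_divide_factor_le:
  fixes c y :: complex
  assumes y: "norm y < 1"
  shows "norm (c / (1 - y * q ^ n)) \<le> norm c / (1 - norm y)"
proof -
  have "1 - norm y \<le> norm (1 - y * q ^ n)"
    using norm_triangle_ineq2[of 1 "y * q ^ n"] power_norm_le[OF q, of y n] unfolding norm_one by linarith
  then show ?thesis unfolding norm_divide using y by (intro divide_left_mono mult_pos_pos) auto
qed

end

lemma qpoch_inf_0 [simp]: "qpoch_inf 0 q = 1"
  by (simp add: qpoch_inf_def qpoch_def)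

lemma qpoch_inf_split:
  assumes "norm q < 1"
  shows "qpoch_inf a q = qpoch_inf a (q\<^sup>2) * qpoch_inf (a * q) (q\<^sup>2)"
proof (rule LIMSEQ_unique)
  have "strict_mono (\<lambda>n::nat. 2 * n)" by (auto intro: strict_monoI)
  from LIMSEQ_subseq_LIMSEQ[OF qpoch_tendsto[OF assms] this]
  show "(\<lambda>n. qpoch a q (2 * n)) \<longlonglongrightarrow> qpoch_inf a q" by (simp add: o_def)
  show "(\<lambda>n. qpoch a q (2 * n)) \<longlonglongrightarrow> qpoch_inf a (q\<^sup>2) * qpoch_inf (a * q) (q\<^sup>2)"
    unfolding qpoch_split by (intro tendsto_mult qpoch_tendsto norm_square_less_1 assms)
qed

lemma qpoch_inf_square:
  assumes "norm q < 1"
  shows "qpoch_inf a q * qpoch_inf (- a) q = qpoch_inf (a\<^sup>2) (q\<^sup>2)"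
proof (rule LIMSEQ_unique)
  show "(\<lambda>n. qpoch a q n * qpoch (- a) q n) \<longlonglongrightarrow> qpoch_inf a q * qpoch_inf (- a) q"
    by (intro tendsto_mult qpoch_tendsto assms)
  show "(\<lambda>n. qpoch a q n * qpoch (- a) q n) \<longlonglongrightarrow> qpoch_inf (a\<^sup>2) (q\<^sup>2)"
    unfolding qpoch_square by (intro qpoch_tendsto norm_square_less_1 assms)
qed

lemma qpoch_inf_tendsto_1:
  assumes q: "norm q < 1" and a: "norm a < 1"
  shows "(\<lambda>n. qpoch_inf (a * q ^ n) q) \<longlonglongrightarrow> 1"
proof -
  have "(\<lambda>n. qpoch_inf a q / qpoch a q n) \<longlonglongrightarrow> qpoch_inf a q / qpoch_inf a q"
    by (intro tendsto_intros qpoch_tendsto qpoch_inf_nonzero q a)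
  moreover have "qpoch_inf a q / qpoch a q n = qpoch_inf (a * q ^ n) q" for n
    using qpoch_inf_add[OF q, of a n] qpoch_nonzero[OF q a] by simp
  ultimately show ?thesis using qpoch_inf_nonzero[OF q a] by simp
qed

subsection \<open>Ramanujan's bilateral summation\<close>

text \<open>The q-binomial theorem with \<open>\<alpha> = 1 / a\<close>, written so that
  \<open>\<alpha> = 0\<close> is Euler's series for \<open>qpoch_inf z p\<close>. As a function of
  \<open>z\<close> the sum \<open>B\<close> satisfies a first order equation under
  \<open>z \<mapsto> z p\<close>, which is iterated down to \<open>B 0 = 1\<close>.\<close>

lemma q_binomial:
  assumes p: "norm p < 1" and z: "norm (\<alpha> * z) < 1"
  shows "(\<Sum>m. \<Prod>k<m. (\<alpha> - p ^ k) * z / (1 - p ^ Suc k)) * qpoch_inf (\<alpha> * z) p = qpoch_inf z p"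
proof -
  define c where "c y m = (\<Prod>k<m. (\<alpha> - p ^ k) * y / (1 - p ^ Suc k))" for y m
  define B where "B y = (\<Sum>m. c y m)" for y
  have nz: "1 - p ^ Suc k \<noteq> 0" for k
    using qpoch_factor_nonzero[OF p p, of k] by simp
  have ratio: "c y (Suc m) = ((\<alpha> - p ^ m) * y / (1 - p ^ Suc m)) * c y m" for y m
    by (simp add: c_def)
  have lim: "(\<lambda>k. norm ((\<alpha> - p ^ k) * y / (1 - p ^ Suc k))) \<longlonglongrightarrow> norm ((\<alpha> - 0) * y / (1 - 0))" for y
    by (intro tendsto_intros LIMSEQ_power_zero[OF p] LIMSEQ_Suc[OF LIMSEQ_power_zero[OF p]]) auto
  have smm: "summable (c y)" if "norm (\<alpha> * y) < 1" for y
    by (rule summable_ratio_limit[OF _ lim]) (use that in \<open>auto simp only: ratio norm_mult, auto simp: norm_mult\<close>)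
  have step: "(1 - \<alpha> * y) * B y = (1 - y) * B (y * p)" if y: "norm (\<alpha> * y) < 1" for y
  proof -
    have yp: "norm (\<alpha> * (y * p)) < 1"
      using power_norm_le[OF p, of "\<alpha> * y" 1] y by (simp add: mult_ac)
    have "c (y * p) m = p ^ m * c y m" for m
      by (induction m) (simp_all add: c_def mult_ac)
    then have cp: "c (y * p) = (\<lambda>m. p ^ m * c y m)" by blast
    have s1: "c y sums B y" unfolding B_def by (rule summable_sums[OF smm[OF y]])
    have s2: "(\<lambda>m. p ^ m * c y m) sums B (y * p)"
      using summable_sums[OF smm[OF yp]] unfolding B_def cp .
    \<comment> \<open>Passing from \<open>B y\<close> to \<open>B y - B (y * p)\<close> multiplies
      the term \<open>m\<close> by \<open>1 - p ^ m\<close>. This removes the term 0 and cancels the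
      newest denominator of every other term.\<close>
    have "(\<lambda>m. c y (Suc m) - p ^ Suc m * c y (Suc m)) sums (B y - c y 0 - (B (y * p) - p ^ 0 * c y 0))"
      using sums_Suc_iff[of "c y" "B y - c y 0"] s1
        sums_Suc_iff[of "\<lambda>m. p ^ m * c y m" "B (y * p) - p ^ 0 * c y 0"] s2
      by (intro sums_diff) simp_all
    moreover have "c y (Suc m) - p ^ Suc m * c y (Suc m) = \<alpha> * y * c y m - y * (p ^ m * c y m)" for m
    proof -
      have "c y (Suc m) - p ^ Suc m * c y (Suc m) = (1 - p ^ Suc m) * c y (Suc m)"
        by (simp add: algebra_simps)
      also have "\<dots> = (\<alpha> - p ^ m) * y * c y m"
        unfolding ratio using nz[of m] by simp
      finally show ?thesis by (simp add: algebra_simps)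
    qed
    moreover have "(\<lambda>m. \<alpha> * y * c y m - y * (p ^ m * c y m)) sums (\<alpha> * y * B y - y * B (y * p))"
      by (intro sums_diff sums_mult s1 s2)
    ultimately have "B y - c y 0 - (B (y * p) - p ^ 0 * c y 0) = \<alpha> * y * B y - y * B (y * p)"
      by (simp only: sums_unique2)
    then show ?thesis by (simp add: algebra_simps)
  qed
  have iter: "qpoch (\<alpha> * z) p n * B z = qpoch z p n * B (z * p ^ n)" for n
  proof (induction n)
    case (Suc n)
    have "norm (\<alpha> * (z * p ^ n)) < 1"
      using power_norm_le[OF p, of "\<alpha> * z" n] z by (simp add: mult_ac)
    from step[OF this] Suc show ?case
      by (simp add: qpoch_Suc) (metis (no_types, lifting) mult.assoc mult.commute)
  qed simp
  \<comment> \<open>Only the term 0 survives in the limit; the indicator sequence is generated by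
    the limiting ratios 0.\<close>
  have "(\<lambda>n. B (z * p ^ n)) \<longlonglongrightarrow> (\<Sum>k. if k = 0 then 1 else 0)"
    unfolding B_def
  proof (rule tannery_ratio)
    show "c (z * p ^ n) (Suc k) = ((\<alpha> - p ^ k) * (z * p ^ n) / (1 - p ^ Suc k)) * c (z * p ^ n) k" for n k
      by (rule ratio)
    show "(\<lambda>n. (\<alpha> - p ^ k) * (z * p ^ n) / (1 - p ^ Suc k)) \<longlonglongrightarrow> 0" for k
      using power_tendsto_0[OF p, of "(\<alpha> - p ^ k) * z / (1 - p ^ Suc k)"] by (simp add: mult.assoc)
    show "norm ((\<alpha> - p ^ k) * (z * p ^ n) / (1 - p ^ Suc k)) \<le> norm ((\<alpha> - p ^ k) * z / (1 - p ^ Suc k))" for n k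
      using power_norm_le[OF p, of "(\<alpha> - p ^ k) * z / (1 - p ^ Suc k)" n] by (simp add: mult.assoc)
    show "(\<lambda>k. norm ((\<alpha> - p ^ k) * z / (1 - p ^ Suc k))) \<longlonglongrightarrow> norm ((\<alpha> - 0) * z / (1 - 0))"
      by (rule lim)
  qed (use z in \<open>auto simp: c_def\<close>)
  moreover have "(\<Sum>k. if k = 0 then 1 else 0 :: complex) = 1"
    using sums_single[of 0 "\<lambda>_. 1 :: complex"] by (simp add: sums_iff)
  ultimately have "(\<lambda>n. qpoch z p n * B (z * p ^ n)) \<longlonglongrightarrow> qpoch_inf z p * 1"
    by (intro tendsto_mult qpoch_tendsto p) simp
  moreover have "(\<lambda>n. qpoch (\<alpha> * z) p n * B z) \<longlonglongrightarrow> qpoch_inf (\<alpha> * z) p * B z"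
    by (intro tendsto_mult qpoch_tendsto p tendsto_const)
  ultimately have "qpoch_inf (\<alpha> * z) p * B z = qpoch_inf z p"
    unfolding iter using LIMSEQ_unique by fastforce
  then show ?thesis by (simp add: B_def c_def mult.commute)
qed

text \<open>
  The two halves of \<open>\<^sub>1\<psi>\<^sub>1(a; b; p, y) = \<Sum>\<^sub>m (a;p)\<^sub>m / (b;p)\<^sub>m y\<^sup>m\<close> over all integers \<open>m\<close>, in terms of
  \<open>\<alpha> = 1 / a\<close> and \<open>z = a y\<close>, so that the confluent case \<open>a = \<infinity>\<close> (the Jacobi triple product) is \<open>\<alpha> = 0\<close>.
  The term \<open>m = 0\<close> is counted in both halves.
\<close>

definition psi_pos :: "complex \<Rightarrow> complex \<Rightarrow> complex \<Rightarrow> complex \<Rightarrow> nat \<Rightarrow> complex" where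
  "psi_pos p \<alpha> b z m = (\<Prod>k<m. (\<alpha> - p ^ k) * z / (1 - b * p ^ k))"

definition psi_neg :: "complex \<Rightarrow> complex \<Rightarrow> complex \<Rightarrow> complex \<Rightarrow> nat \<Rightarrow> complex" where
  "psi_neg p \<alpha> b z m = (\<Prod>k<m. (p ^ Suc k - b) / ((\<alpha> * p ^ Suc k - 1) * z))"

definition psi :: "complex \<Rightarrow> complex \<Rightarrow> complex \<Rightarrow> complex \<Rightarrow> complex" where
  "psi p \<alpha> b z = (\<Sum>m. psi_pos p \<alpha> b z m) + (\<Sum>m. psi_neg p \<alpha> b z m) - 1"

section \<open>Convergence and evaluation of the bilateral series\<close>

context
  fixes p \<alpha> z :: complex
  assumes p: "norm p < 1" and z: "z \<noteq> 0" and \<alpha>z: "norm (\<alpha> * z) < 1"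
    and \<alpha>: "\<And>k. \<alpha> * p ^ Suc k \<noteq> 1"
begin

lemma psi_pos_Suc: "psi_pos p \<alpha> b z (Suc m) = (\<alpha> - p ^ m) * z / (1 - b * p ^ m) * psi_pos p \<alpha> b z m"
  by (simp add: psi_pos_def)

lemma psi_neg_Suc:
  "psi_neg p \<alpha> b z (Suc m) = (p ^ Suc m - b) / ((\<alpha> * p ^ Suc m - 1) * z) * psi_neg p \<alpha> b z m"
  by (simp add: psi_neg_def)

lemma summable_psi_pos: "summable (psi_pos p \<alpha> b z)"
proof (rule summable_ratio_limit)
  show "(\<lambda>m. norm ((\<alpha> - p ^ m) * z / (1 - b * p ^ m))) \<longlonglongrightarrow> norm ((\<alpha> - 0) * z / (1 - 0))"
    by (intro tendsto_intros LIMSEQ_power_zero[OF p] power_tendsto_0[OF p]) auto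
qed (use \<alpha>z in \<open>auto simp only: psi_pos_Suc norm_mult, auto simp: norm_mult\<close>)

lemma psi_neg_ratio_tendsto:
  "(\<lambda>m. norm ((p ^ Suc m - b) / ((\<alpha> * p ^ Suc m - 1) * z))) \<longlonglongrightarrow> norm ((0 - b) / ((\<alpha> * 0 - 1) * z))"
  using z by (intro tendsto_intros LIMSEQ_Suc[OF LIMSEQ_power_zero[OF p]]) auto

text \<open>The ratios of this half tend to \<open>b / z\<close> in norm, those of the positive half
  to \<open>\<alpha> * z\<close>; the two conditions describe the annulus of convergence.\<close>

lemma summable_psi_neg:
  assumes "norm b < norm z"
  shows "summable (psi_neg p \<alpha> b z)"
proof (rule summable_ratio_limit[OF _ psi_neg_ratio_tendsto])
  show "norm ((0 - b) / ((\<alpha> * 0 - 1) * z)) < 1" using assms z by (simp add: norm_divide)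
qed (simp only: psi_neg_Suc norm_mult)

text \<open>In each half the termwise difference of the two sides is a multiple of a difference of
  consecutive terms. The halves telescope to \<open>- ?K\<close> and \<open>?K\<close>, which
  cancel.\<close>

lemma psi_step:
  assumes b: "norm b < 1" and bz: "norm b < norm z"
  shows "(1 - b) * (1 - b / z) * psi p \<alpha> b z = (1 - b * \<alpha>) * psi p \<alpha> (b * p) z"
proof -
  have bpz: "norm (b * p) < norm z"
    using power_norm_le[OF p, of b 1] bz by simp
  let ?K = "b * (1 - b) / z"
  let ?P = "\<lambda>b. psi_pos p \<alpha> b z" and ?N = "\<lambda>b. psi_neg p \<alpha> b z"
  have lim: "a \<longlonglongrightarrow> 0" if "summable a" for a :: "nat \<Rightarrow> complex"
    using that by (rule summable_LIMSEQ_zero)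
  have pos: "(1 - b) * (1 - b / z) * ?P b m - (1 - b * \<alpha>) * ?P (b * p) m = ?K * (?P b (Suc m) - ?P b m)" for m
  proof -
    define A where "A = (\<Prod>k<m. (\<alpha> - p ^ k) * z)"
    define Q where "Q = qpoch b p m"
    have nz: "1 - b * p ^ m \<noteq> 0" "1 - b \<noteq> 0" "Q \<noteq> 0"
      using qpoch_factor_nonzero[OF p b, of m] one_minus_nonzero[OF b] qpoch_nonzero[OF p b] by (auto simp: Q_def)
    have P: "?P b m = A / Q" by (simp add: psi_pos_def A_def Q_def qpoch_def prod_dividef)
    have "?P (b * p) m = A / qpoch (b * p) p m"
      by (simp add: psi_pos_def A_def qpoch_def prod_dividef)
    also have "\<dots> = A * (1 - b) / (Q * (1 - b * p ^ m))"
      using qpoch_shift[of b p m] nz unfolding Q_def by (metis mult.commute mult_divide_mult_cancel_right)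
    finally have P': "?P (b * p) m = A * (1 - b) / (Q * (1 - b * p ^ m))" .
    show ?thesis unfolding psi_pos_Suc P P' using nz z by (simp add: divide_simps) algebra
  qed
  \<comment> \<open>Only indices from 1 on are compared, since the term 0 is assigned to the
    positive half.\<close>
  have neg: "(1 - b) * (1 - b / z) * ?N b (Suc m) - (1 - b * \<alpha>) * ?N (b * p) (Suc m) = ?K * (?N b m - ?N b (Suc m))" for m
  proof -
    define D where "D = \<alpha> * p ^ Suc m - 1"
    have D: "D \<noteq> 0" using \<alpha>[of m] by (simp add: D_def)
    \<comment> \<open>Each factor is \<open>p * (p ^ k - b)\<close>, so replacing \<open>b\<close>
      by \<open>b * p\<close> shifts the product by one index and leaves \<open>1 - b\<close> from
      \<open>k = 0\<close>.\<close>
    have "(\<Prod>k<Suc n. p ^ Suc k - b * p) = p ^ Suc n * (1 - b) * (\<Prod>k<n. p ^ Suc k - b)" for n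
    proof (induction n)
      case (Suc n)
      show ?case by (subst prod.lessThan_Suc) (simp only: Suc, simp add: algebra_simps)
    qed (simp add: algebra_simps)
    from this[of m] have N': "?N (b * p) (Suc m) = p ^ Suc m * (1 - b) / (D * z) * ?N b m"
      unfolding psi_neg_def prod_dividef D_def by (simp add: field_simps del: power_Suc)
    have "(1 - b) * (1 - b / z) * ((p ^ Suc m - b) / (D * z)) - (1 - b * \<alpha>) * (p ^ Suc m * (1 - b) / (D * z))
        = ?K * (1 - (p ^ Suc m - b) / (D * z))"
      using D z by (simp add: divide_simps del: power_Suc) (simp add: D_def algebra_simps del: power_Suc)
    moreover have "X * (r * N) - Y * (s * N) = K * (N - r * N)" if "X * r - Y * s = K * (1 - r)"
      for X Y K r s N :: complex
      using that by algebra
    ultimately show ?thesis unfolding N' unfolding psi_neg_Suc D_def[symmetric] by blast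
  qed
  have sumN: "suminf (?N c) = 1 + (\<Sum>m. ?N c (Suc m))" if "norm c < norm z" for c
    using suminf_split_head[OF summable_psi_neg[OF that]] by (simp add: psi_neg_def)
  have "(\<lambda>m. ?K * (?P b (Suc m) - ?P b m)) sums (?K * (0 - ?P b 0))"
    by (intro sums_mult telescope_sums lim summable_psi_pos)
  moreover have "(\<lambda>m. (1 - b) * (1 - b / z) * ?P b m - (1 - b * \<alpha>) * ?P (b * p) m)
      sums ((1 - b) * (1 - b / z) * suminf (?P b) - (1 - b * \<alpha>) * suminf (?P (b * p)))"
    by (intro sums_diff sums_mult summable_sums summable_psi_pos)
  ultimately have 1: "(1 - b) * (1 - b / z) * suminf (?P b) - (1 - b * \<alpha>) * suminf (?P (b * p)) = - ?K"
    unfolding pos using sums_unique2 by (fastforce simp: psi_pos_def)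
  have "(\<lambda>m. ?K * (?N b m - ?N b (Suc m))) sums (?K * (?N b 0 - 0))"
    by (intro sums_mult telescope_sums' lim summable_psi_neg bz)
  moreover have "(\<lambda>m. (1 - b) * (1 - b / z) * ?N b (Suc m) - (1 - b * \<alpha>) * ?N (b * p) (Suc m))
      sums ((1 - b) * (1 - b / z) * (suminf (?N b) - 1) - (1 - b * \<alpha>) * (suminf (?N (b * p)) - 1))"
    using sumN[OF bz] sumN[OF bpz]
    by (intro sums_diff sums_mult)
       (metis add_diff_cancel_left' summable_Suc_iff summable_psi_neg summable_sums bz,
        metis add_diff_cancel_left' summable_Suc_iff summable_psi_neg summable_sums bpz)
  ultimately have 2: "(1 - b) * (1 - b / z) * (suminf (?N b) - 1) - (1 - b * \<alpha>) * (suminf (?N (b * p)) - 1) = ?K"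
    unfolding neg using sums_unique2 by (fastforce simp: psi_neg_def)
  show ?thesis using 1 2 unfolding psi_def by (simp add: algebra_simps)
qed

lemma psi_tendsto_0:
  assumes b: "norm b < 1" and bz: "norm b < norm z"
  shows "(\<lambda>n. psi p \<alpha> (b * p ^ n) z) \<longlonglongrightarrow> psi p \<alpha> 0 z"
  unfolding psi_def
proof (intro tendsto_intros)
  show "(\<lambda>n. \<Sum>m. psi_pos p \<alpha> (b * p ^ n) z m) \<longlonglongrightarrow> (\<Sum>m. psi_pos p \<alpha> 0 z m)"
  proof (rule tannery_ratio)
    show "psi_pos p \<alpha> (b * p ^ n) z (Suc k) = (\<alpha> - p ^ k) * z / (1 - b * p ^ n * p ^ k) * psi_pos p \<alpha> (b * p ^ n) z k" for n k
      by (rule psi_pos_Suc)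
    show "psi_pos p \<alpha> 0 z (Suc k) = (\<alpha> - p ^ k) * z / (1 - 0 * p ^ k) * psi_pos p \<alpha> 0 z k" for k
      by (rule psi_pos_Suc)
    have "(\<lambda>n. (\<alpha> - p ^ k) * z / (1 - b * p ^ n * p ^ k)) \<longlonglongrightarrow> (\<alpha> - p ^ k) * z / (1 - 0 * p ^ k)" for k
      by (intro tendsto_intros power_tendsto_0[OF p]) auto
    then show "(\<lambda>n. (\<alpha> - p ^ k) * z / (1 - b * p ^ n * p ^ k)) \<longlonglongrightarrow> (\<alpha> - p ^ k) * z / (1 - 0 * p ^ k)" for k .
    \<comment> \<open>Keeping \<open>p ^ k\<close> in the bound makes its denominator tend to 1, so
      that the majorant ratio tends to \<open>norm (\<alpha> * z)\<close>.\<close>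
    show "norm ((\<alpha> - p ^ k) * z / (1 - b * p ^ n * p ^ k)) \<le> norm ((\<alpha> - p ^ k) * z) / (1 - norm (b * p ^ k))" for n k
      using norm_divide_factor_le[OF p le_less_trans[OF power_norm_le[OF p, of b k] b], of "(\<alpha> - p ^ k) * z" n]
      by (simp add: mult_ac)
    show "(\<lambda>k. norm ((\<alpha> - p ^ k) * z) / (1 - norm (b * p ^ k))) \<longlonglongrightarrow> norm ((\<alpha> - 0) * z) / (1 - norm (0::complex))"
      by (intro tendsto_intros power_tendsto_0[OF p] LIMSEQ_power_zero[OF p]) auto
  qed (use \<alpha>z in \<open>auto simp: psi_pos_def\<close>)
  show "(\<lambda>n. \<Sum>m. psi_neg p \<alpha> (b * p ^ n) z m) \<longlonglongrightarrow> (\<Sum>m. psi_neg p \<alpha> 0 z m)"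
  proof (rule tannery_ratio)
    show "psi_neg p \<alpha> (b * p ^ n) z (Suc k)
        = (p ^ Suc k - b * p ^ n) / ((\<alpha> * p ^ Suc k - 1) * z) * psi_neg p \<alpha> (b * p ^ n) z k" for n k
      by (rule psi_neg_Suc)
    show "psi_neg p \<alpha> 0 z (Suc k) = (p ^ Suc k - 0) / ((\<alpha> * p ^ Suc k - 1) * z) * psi_neg p \<alpha> 0 z k" for k
      by (rule psi_neg_Suc)
    show "(\<lambda>n. (p ^ Suc k - b * p ^ n) / ((\<alpha> * p ^ Suc k - 1) * z)) \<longlonglongrightarrow> (p ^ Suc k - 0) / ((\<alpha> * p ^ Suc k - 1) * z)" for k
      using \<alpha>[of k] z by (intro tendsto_intros power_tendsto_0[OF p]) auto
    show "norm ((p ^ Suc k - b * p ^ n) / ((\<alpha> * p ^ Suc k - 1) * z)) \<le> (norm (p ^ Suc k) + norm b) / norm ((\<alpha> * p ^ Suc k - 1) * z)" for n k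
      unfolding norm_divide
      using norm_triangle_ineq4[of "p ^ Suc k" "b * p ^ n"] power_norm_le[OF p, of b n]
      by (intro divide_right_mono) auto
    show "(\<lambda>k. (norm (p ^ Suc k) + norm b) / norm ((\<alpha> * p ^ Suc k - 1) * z)) \<longlonglongrightarrow> (norm (0::complex) + norm b) / norm ((\<alpha> * 0 - 1) * z)"
      using z by (intro tendsto_intros LIMSEQ_Suc[OF LIMSEQ_power_zero[OF p]]) auto
  qed (use z bz in \<open>auto simp: psi_neg_def norm_mult\<close>)
qed

text \<open>Iterating \<open>psi_step\<close> moves \<open>b\<close> to \<open>b * p ^ n\<close>,
  and \<open>psi\<close> converges along this orbit to its value at \<open>b = 0\<close>.\<close>

lemma psi_eq_psi_0:
  assumes b: "norm b < 1" and bz: "norm b < norm z"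
  shows "qpoch_inf b p * qpoch_inf (b / z) p * psi p \<alpha> b z = qpoch_inf (b * \<alpha>) p * psi p \<alpha> 0 z"
proof -
  have iter: "qpoch b p n * qpoch (b / z) p n * psi p \<alpha> b z = qpoch (b * \<alpha>) p n * psi p \<alpha> (b * p ^ n) z" for n
  proof (induction n)
    case (Suc n)
    have "norm (b * p ^ n) < 1" "norm (b * p ^ n) < norm z"
      using power_norm_le[OF p, of b n] b bz by linarith+
    note step = psi_step[OF this]
    have "qpoch b p (Suc n) * qpoch (b / z) p (Suc n) * psi p \<alpha> b z
        = (1 - b * p ^ n) * (1 - b * p ^ n / z) * (qpoch b p n * qpoch (b / z) p n * psi p \<alpha> b z)"
      by (simp add: qpoch_Suc mult_ac)
    also have "\<dots> = qpoch (b * \<alpha>) p n * ((1 - b * p ^ n) * (1 - b * p ^ n / z) * psi p \<alpha> (b * p ^ n) z)"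
      unfolding Suc by (simp only: mult_ac)
    also have "\<dots> = qpoch (b * \<alpha>) p (Suc n) * psi p \<alpha> (b * p ^ Suc n) z"
      unfolding step by (simp add: qpoch_Suc mult_ac)
    finally show ?case .
  qed simp
  have "(\<lambda>n. qpoch b p n * qpoch (b / z) p n * psi p \<alpha> b z) \<longlonglongrightarrow> qpoch_inf b p * qpoch_inf (b / z) p * psi p \<alpha> b z"
    by (intro tendsto_intros qpoch_tendsto p)
  moreover have "(\<lambda>n. qpoch (b * \<alpha>) p n * psi p \<alpha> (b * p ^ n) z) \<longlonglongrightarrow> qpoch_inf (b * \<alpha>) p * psi p \<alpha> 0 z"
    by (intro tendsto_intros qpoch_tendsto psi_tendsto_0 p b bz)
  ultimately show ?thesis unfolding iter using LIMSEQ_unique by blast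
qed

text \<open>At \<open>b = p\<close> the factor \<open>p - b\<close> kills every term of the negative
  half except the term 0, and the positive half becomes the q-binomial series. This known value is
  carried to \<open>b = 0\<close> by \<open>psi_eq_psi_0\<close>.\<close>

lemma psi_0:
  assumes pz: "norm p < norm z"
  shows "qpoch_inf (\<alpha> * z) p * qpoch_inf (p * \<alpha>) p * psi p \<alpha> 0 z = qpoch_inf z p * qpoch_inf p p * qpoch_inf (p / z) p"
proof -
  have "psi_neg p \<alpha> p z = (\<lambda>m. if m = 0 then 1 else 0)"
    by (auto simp: psi_neg_def fun_eq_iff prod_zero_iff intro!: bexI[of _ 0])
  then have "(\<Sum>m. psi_neg p \<alpha> p z m) = 1"
    using sums_single[of 0 "\<lambda>_. 1 :: complex"] by (simp add: sums_iff)
  then have "psi p \<alpha> p z = (\<Sum>m. \<Prod>k<m. (\<alpha> - p ^ k) * z / (1 - p ^ Suc k))"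
    by (simp add: psi_def psi_pos_def)
  with q_binomial[OF p \<alpha>z] have "psi p \<alpha> p z * qpoch_inf (\<alpha> * z) p = qpoch_inf z p" by simp
  with psi_eq_psi_0[OF p pz] show ?thesis by (metis mult.assoc mult.commute)
qed

end

subsection \<open>Functional equations\<close>

context
  fixes p :: complex
  assumes p: "norm p < 1"
begin

text \<open>For \<open>p = q\<^sup>2\<close> and \<open>x = - q\<close> the denominator is
  \<open>qpoch (- q) q (2 * Suc n)\<close>: the two symbols collect its even and odd
  exponents.\<close>

definition E_term :: "complex \<Rightarrow> nat \<Rightarrow> complex" where
  "E_term x n = p ^ Suc n / (qpoch (- p) p (Suc n) * qpoch x p (Suc n))"

definition G_term :: "complex \<Rightarrow> nat \<Rightarrow> complex" where
  "G_term x n = p ^ Suc n * qpoch p p n / (qpoch (- p) p (Suc n) * qpoch x p (Suc n))"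

text \<open>This is \<open>x ^ m * qpoch (- 1) p m\<close>. The product form gives the term ratio at
  once and matches the factors of \<open>psi_pos\<close>.\<close>

definition P_term :: "complex \<Rightarrow> nat \<Rightarrow> complex" where
  "P_term x m = (\<Prod>k<m. x * (1 + p ^ k))"

definition partial_theta_term :: "complex \<Rightarrow> nat \<Rightarrow> complex" where
  "partial_theta_term x m = (\<Prod>k<m. x * p ^ k)"

definition Lambert_term :: "complex \<Rightarrow> nat \<Rightarrow> complex" where
  "Lambert_term x m = x ^ m / (1 + p ^ m)"

text \<open>This is \<open>partial_theta_term x m / qpoch (- p) p m\<close>, in the product form of
  \<open>psi_neg\<close>.\<close>

definition Phi_term :: "complex \<Rightarrow> nat \<Rightarrow> complex" where
  "Phi_term x m = (\<Prod>k<m. x * p ^ k / (1 + p ^ Suc k))"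

lemma one_plus_power_Suc_nonzero: "1 + p ^ Suc k \<noteq> 0"
  using qpoch_factor_nonzero[OF p, of "- p" k] p by simp

lemma E_term_Suc: "E_term x (Suc n) = p / ((1 + p ^ Suc (Suc n)) * (1 - x * p ^ Suc n)) * E_term x n"
  by (simp add: E_term_def qpoch_Suc[of _ _ "Suc n"] mult_ac del: power_Suc) (simp add: power_Suc)

lemma G_term_Suc:
  "G_term x (Suc n) = p * (1 - p ^ Suc n) / ((1 + p ^ Suc (Suc n)) * (1 - x * p ^ Suc n)) * G_term x n"
  by (simp add: G_term_def qpoch_Suc[of _ _ "Suc n"] qpoch_Suc[of p p n] mult_ac)

lemma P_term_Suc: "P_term x (Suc m) = x * (1 + p ^ m) * P_term x m"
  by (simp add: P_term_def)

lemma partial_theta_term_Suc: "partial_theta_term x (Suc m) = x * p ^ m * partial_theta_term x m"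
  by (simp add: partial_theta_term_def)

lemma Lambert_term_Suc: "Lambert_term x (Suc m) = x * (1 + p ^ m) / (1 + p ^ Suc m) * Lambert_term x m"
proof -
  have "1 + p ^ m \<noteq> 0" using one_plus_power_Suc_nonzero[of "m - 1"] by (cases m) auto
  then show ?thesis by (simp add: Lambert_term_def)
qed

lemma Phi_term_Suc: "Phi_term x (Suc m) = x * p ^ m / (1 + p ^ Suc m) * Phi_term x m"
  by (simp add: Phi_term_def)

lemmas power_limits = tendsto_intros LIMSEQ_power_zero[OF p] LIMSEQ_Suc[OF LIMSEQ_power_zero[OF p]]
  LIMSEQ_Suc[OF LIMSEQ_Suc[OF LIMSEQ_power_zero[OF p]]] power_tendsto_0[OF p]
  LIMSEQ_Suc[OF power_tendsto_0[OF p]]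

section \<open>Convergence of the auxiliary series and their limits at zero\<close>

context
  fixes x :: complex
  assumes x: "norm x < 1"
begin

lemma denominators_nonzero: "1 - x \<noteq> 0" "1 - x * p ^ n \<noteq> 0" "qpoch x p n \<noteq> 0" "qpoch (- p) p n \<noteq> 0"
  "qpoch_inf x p \<noteq> 0" "qpoch_inf (- p) p \<noteq> 0"
  using one_minus_nonzero[OF x] qpoch_factor_nonzero[OF p x] qpoch_nonzero[OF p x] qpoch_inf_nonzero[OF p x]
    qpoch_nonzero[OF p, of "- p"] qpoch_inf_nonzero[OF p, of "- p"] p by auto

lemma summable_E_term: "summable (E_term x)"
proof (rule summable_ratio_limit)
  show "(\<lambda>n. norm (p / ((1 + p ^ Suc (Suc n)) * (1 - x * p ^ Suc n)))) \<longlonglongrightarrow> norm (p / ((1 + 0) * (1 - 0)))"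
    by (intro power_limits) auto
qed (use p in \<open>simp_all only: E_term_Suc norm_mult, simp_all\<close>)

lemma summable_G_term: "summable (G_term x)"
proof (rule summable_ratio_limit)
  show "(\<lambda>n. norm (p * (1 - p ^ Suc n) / ((1 + p ^ Suc (Suc n)) * (1 - x * p ^ Suc n))))
      \<longlonglongrightarrow> norm (p * (1 - 0) / ((1 + 0) * (1 - 0)))"
    by (intro power_limits) auto
qed (use p in \<open>simp_all only: G_term_Suc norm_mult, simp_all\<close>)

lemma summable_P_term: "summable (P_term x)"
proof (rule summable_ratio_limit)
  show "(\<lambda>n. norm (x * (1 + p ^ n))) \<longlonglongrightarrow> norm (x * (1 + 0))"
    by (intro power_limits)
qed (use x in \<open>simp_all only: P_term_Suc norm_mult, simp_all\<close>)

lemma summable_partial_theta_term: "summable (partial_theta_term x)"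
proof (rule summable_ratio_limit)
  show "(\<lambda>n. norm (x * p ^ n)) \<longlonglongrightarrow> norm (x * 0)"
    by (intro power_limits)
qed (simp_all only: partial_theta_term_Suc norm_mult, simp_all)

lemma summable_Lambert_term: "summable (Lambert_term x)"
proof (rule summable_ratio_limit)
  show "(\<lambda>n. norm (x * (1 + p ^ n) / (1 + p ^ Suc n))) \<longlonglongrightarrow> norm (x * (1 + 0) / (1 + 0))"
    by (intro power_limits) auto
qed (use x in \<open>simp_all only: Lambert_term_Suc norm_mult, simp_all\<close>)

lemma summable_Phi_term: "summable (Phi_term x)"
proof (rule summable_ratio_limit)
  show "(\<lambda>n. norm (x * p ^ n / (1 + p ^ Suc n))) \<longlonglongrightarrow> norm (x * 0 / (1 + 0))"
    by (intro power_limits) auto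
qed (simp_all only: Phi_term_Suc norm_mult, simp_all)

text \<open>Uniform in \<open>n\<close>, yet tending to \<open>norm c\<close> as \<open>k\<close>
  grows, so it does not enlarge the limiting ratio of a majorant.\<close>

lemma norm_factor_bound:
  "norm (c / (1 - x * p ^ n * p ^ Suc k)) \<le> norm c / (1 - norm (x * p ^ Suc k))"
  using norm_divide_factor_le[OF p le_less_trans[OF power_norm_le[OF p, of x "Suc k"] x], of c n]
  by (simp add: mult_ac)

lemma E_tendsto: "(\<lambda>n. suminf (E_term (x * p ^ n))) \<longlonglongrightarrow> suminf (E_term 0)"
proof (rule tannery_ratio)
  show "(\<lambda>n. E_term (x * p ^ n) 0) \<longlonglongrightarrow> E_term 0 0"
    unfolding E_term_def qpoch_Suc qpoch_0
    using one_plus_power_Suc_nonzero[of 0] by (intro power_limits) auto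
  show "(\<lambda>n. p / ((1 + p ^ Suc (Suc k)) * (1 - x * p ^ n * p ^ Suc k)))
      \<longlonglongrightarrow> p / ((1 + p ^ Suc (Suc k)) * (1 - 0 * p ^ Suc k))" for k
    using one_plus_power_Suc_nonzero[of "Suc k"] by (intro power_limits) auto
  show "norm (p / ((1 + p ^ Suc (Suc k)) * (1 - x * p ^ n * p ^ Suc k)))
      \<le> norm (p / (1 + p ^ Suc (Suc k))) / (1 - norm (x * p ^ Suc k))" for n k
    using norm_factor_bound[of "p / (1 + p ^ Suc (Suc k))"] by simp
  show "(\<lambda>k. norm (p / (1 + p ^ Suc (Suc k))) / (1 - norm (x * p ^ Suc k)))
      \<longlonglongrightarrow> norm (p / (1 + 0)) / (1 - norm (0::complex))"
    by (intro power_limits) auto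
qed (use p in \<open>simp_all only: E_term_Suc, simp_all\<close>)

lemma G_tendsto: "(\<lambda>n. suminf (G_term (x * p ^ n))) \<longlonglongrightarrow> suminf (G_term 0)"
proof (rule tannery_ratio)
  show "(\<lambda>n. G_term (x * p ^ n) 0) \<longlonglongrightarrow> G_term 0 0"
    unfolding G_term_def qpoch_Suc qpoch_0
    using one_plus_power_Suc_nonzero[of 0] by (intro power_limits) auto
  show "(\<lambda>n. p * (1 - p ^ Suc k) / ((1 + p ^ Suc (Suc k)) * (1 - x * p ^ n * p ^ Suc k)))
      \<longlonglongrightarrow> p * (1 - p ^ Suc k) / ((1 + p ^ Suc (Suc k)) * (1 - 0 * p ^ Suc k))" for k
    using one_plus_power_Suc_nonzero[of "Suc k"] by (intro power_limits) auto
  show "norm (p * (1 - p ^ Suc k) / ((1 + p ^ Suc (Suc k)) * (1 - x * p ^ n * p ^ Suc k)))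
      \<le> norm (p * (1 - p ^ Suc k) / (1 + p ^ Suc (Suc k))) / (1 - norm (x * p ^ Suc k))" for n k
    using norm_factor_bound[of "p * (1 - p ^ Suc k) / (1 + p ^ Suc (Suc k))"] by simp
  show "(\<lambda>k. norm (p * (1 - p ^ Suc k) / (1 + p ^ Suc (Suc k))) / (1 - norm (x * p ^ Suc k)))
      \<longlonglongrightarrow> norm (p * (1 - 0) / (1 + 0)) / (1 - norm (0::complex))"
    by (intro power_limits) auto
qed (use p in \<open>simp_all only: G_term_Suc, simp_all\<close>)

lemma P_tendsto: "(\<lambda>n. suminf (P_term (x * p ^ n))) \<longlonglongrightarrow> suminf (P_term 0)"
proof (rule tannery_ratio)
  show "(\<lambda>n. x * p ^ n * (1 + p ^ k)) \<longlonglongrightarrow> 0 * (1 + p ^ k)" for k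
    by (intro power_limits)
  show "norm (x * p ^ n * (1 + p ^ k)) \<le> norm x * norm (1 + p ^ k)" for n k
    unfolding norm_mult[of "x * p ^ n"] by (intro mult_right_mono power_norm_le p) auto
  show "(\<lambda>k. norm x * norm (1 + p ^ k)) \<longlonglongrightarrow> norm x * norm (1 + (0::complex))"
    by (intro power_limits)
qed (use x in \<open>simp_all only: P_term_Suc, simp_all add: P_term_def\<close>)

lemma partial_theta_tendsto:
  "(\<lambda>n. suminf (partial_theta_term (x * p ^ n))) \<longlonglongrightarrow> suminf (partial_theta_term 0)"
proof (rule tannery_ratio)
  show "(\<lambda>n. x * p ^ n * p ^ k) \<longlonglongrightarrow> 0 * p ^ k" for k
    by (intro power_limits)
  show "norm (x * p ^ n * p ^ k) \<le> norm x * norm (p ^ k)" for n k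
    unfolding norm_mult[of "x * p ^ n"] by (intro mult_right_mono power_norm_le p) auto
  show "(\<lambda>k. norm x * norm (p ^ k)) \<longlonglongrightarrow> norm x * norm (0::complex)"
    by (intro power_limits)
qed (simp_all only: partial_theta_term_Suc, simp_all add: partial_theta_term_def)

lemma Lambert_tendsto: "(\<lambda>n. suminf (Lambert_term (x * p ^ n))) \<longlonglongrightarrow> suminf (Lambert_term 0)"
proof (rule tannery_ratio)
  show "(\<lambda>n. x * p ^ n * (1 + p ^ k) / (1 + p ^ Suc k)) \<longlonglongrightarrow> 0 * (1 + p ^ k) / (1 + p ^ Suc k)" for k
    using one_plus_power_Suc_nonzero[of k] by (intro power_limits) auto
  show "norm (x * p ^ n * (1 + p ^ k) / (1 + p ^ Suc k)) \<le> norm x * norm ((1 + p ^ k) / (1 + p ^ Suc k))" for n k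
    unfolding times_divide_eq_right[symmetric] norm_mult[of "x * p ^ n"]
    by (intro mult_right_mono power_norm_le p) auto
  show "(\<lambda>k. norm x * norm ((1 + p ^ k) / (1 + p ^ Suc k))) \<longlonglongrightarrow> norm x * norm ((1 + 0) / (1 + 0 :: complex))"
    by (intro power_limits) auto
qed (use x in \<open>simp_all only: Lambert_term_Suc, simp_all add: Lambert_term_def\<close>)

lemma Phi_tendsto: "(\<lambda>n. suminf (Phi_term (x * p ^ n))) \<longlonglongrightarrow> suminf (Phi_term 0)"
proof (rule tannery_ratio)
  show "(\<lambda>n. x * p ^ n * p ^ k / (1 + p ^ Suc k)) \<longlonglongrightarrow> 0 * p ^ k / (1 + p ^ Suc k)" for k
    using one_plus_power_Suc_nonzero[of k] by (intro power_limits) auto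
  show "norm (x * p ^ n * p ^ k / (1 + p ^ Suc k)) \<le> norm x * norm (p ^ k / (1 + p ^ Suc k))" for n k
    unfolding times_divide_eq_right[symmetric] norm_mult[of "x * p ^ n"]
    by (intro mult_right_mono power_norm_le p) auto
  show "(\<lambda>k. norm x * norm (p ^ k / (1 + p ^ Suc k))) \<longlonglongrightarrow> norm x * norm (0 / (1 + 0 :: complex))"
    by (intro power_limits) auto
qed (simp_all only: Phi_term_Suc, simp_all add: Phi_term_def)

end

section \<open>First order functional equations by telescoping\<close>

context
  fixes x :: complex
  assumes x: "norm x < 1"
begin

lemma norm_xp: "norm (x * p) < 1"
  using power_norm_le[OF p, of x 1] x by simp

text \<open>The combination of terms is the difference of consecutive values of \<open>T\<close>,
  with \<open>T 0 = 1\<close>; the product on the right is the limit of \<open>T\<close>.\<close>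

lemma E_step: "(1 - x) * suminf (E_term x) - x * suminf (E_term (x * p))
    = 1 - 1 / (qpoch_inf (- p) p * qpoch_inf (x * p) p)"
proof -
  define T where "T n = 1 / (qpoch (- p) p n * qpoch (x * p) p n)" for n
  have "T \<longlonglongrightarrow> 1 / (qpoch_inf (- p) p * qpoch_inf (x * p) p)"
    unfolding T_def using denominators_nonzero[OF norm_xp]
    by (intro tendsto_intros qpoch_tendsto p) auto
  then have "(\<lambda>n. T n - T (Suc n)) sums (T 0 - 1 / (qpoch_inf (- p) p * qpoch_inf (x * p) p))"
    by (rule telescope_sums')
  moreover have "T n - T (Suc n) = (1 - x) * E_term x n - x * E_term (x * p) n" for n
  proof -
    define A B z where "A = qpoch (- p) p n" and "B = qpoch (x * p) p n" and "z = p ^ Suc n"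
    have nz: "A \<noteq> 0" "B \<noteq> 0" "1 + z \<noteq> 0" "1 - x * z \<noteq> 0" "1 - x \<noteq> 0"
      using denominators_nonzero[OF norm_xp] denominators_nonzero[OF x] one_plus_power_Suc_nonzero[of n] by (auto simp: A_def B_def z_def mult.assoc)
    have A: "qpoch (- p) p (Suc n) = A * (1 + z)" by (simp add: A_def z_def qpoch_Suc)
    have B: "qpoch (x * p) p (Suc n) = B * (1 - x * z)" by (simp add: B_def z_def qpoch_Suc mult_ac)
    have B': "qpoch x p (Suc n) = (1 - x) * B"
      using qpoch_shift[of x p n] by (simp add: B_def qpoch_Suc)
    show ?thesis
      unfolding T_def E_term_def A B B' A_def[symmetric] B_def[symmetric] z_def[symmetric]
      using nz by (simp add: divide_simps) algebra
  qed
  moreover have "(\<lambda>n. (1 - x) * E_term x n - x * E_term (x * p) n)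
      sums ((1 - x) * suminf (E_term x) - x * suminf (E_term (x * p)))"
    by (intro sums_diff sums_mult summable_sums summable_E_term x norm_xp)
  ultimately show ?thesis using sums_unique2 by (fastforce simp: T_def)
qed

text \<open>Here too the sum of terms is a difference of consecutive values of some
  \<open>T\<close>, whose initial value is \<open>1 / (1 - x)\<close>.\<close>

lemma G_step: "suminf (G_term x) + suminf (G_term (x * p))
    = 1 / (1 - x) - qpoch_inf p p / (qpoch_inf (- p) p * qpoch_inf x p)"
proof -
  define T where "T n = qpoch p p n / (qpoch (- p) p n * qpoch x p (Suc n))" for n
  have "T \<longlonglongrightarrow> qpoch_inf p p / (qpoch_inf (- p) p * qpoch_inf x p)"
    unfolding T_def using denominators_nonzero[OF x]
    by (intro tendsto_intros qpoch_tendsto LIMSEQ_Suc[OF qpoch_tendsto] p) auto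
  then have "(\<lambda>n. T n - T (Suc n)) sums (T 0 - qpoch_inf p p / (qpoch_inf (- p) p * qpoch_inf x p))"
    by (rule telescope_sums')
  moreover have "T n - T (Suc n) = G_term x n + G_term (x * p) n" for n
  proof -
    define A B C z where "A = qpoch (- p) p n" and "B = qpoch (x * p) p n" and "C = qpoch p p n" and "z = p ^ Suc n"
    have nz: "A \<noteq> 0" "B \<noteq> 0" "1 + z \<noteq> 0" "1 - x * z \<noteq> 0" "1 - x \<noteq> 0"
      using denominators_nonzero[OF norm_xp] denominators_nonzero[OF x] one_plus_power_Suc_nonzero[of n] by (auto simp: A_def B_def z_def mult.assoc)
    have A: "qpoch (- p) p (Suc n) = A * (1 + z)" by (simp add: A_def z_def qpoch_Suc)
    have B: "qpoch (x * p) p (Suc n) = B * (1 - x * z)" by (simp add: B_def z_def qpoch_Suc mult_ac)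
    have B': "qpoch x p (Suc n) = (1 - x) * B"
      using qpoch_shift[of x p n] by (simp add: B_def qpoch_Suc)
    have B'': "qpoch x p (Suc (Suc n)) = (1 - x) * B * (1 - x * z)"
      using B' by (simp add: z_def qpoch_Suc)
    have C: "qpoch p p (Suc n) = C * (1 - z)" by (simp add: C_def z_def qpoch_Suc)
    show ?thesis
      unfolding T_def G_term_def A B B'' B' C A_def[symmetric] B_def[symmetric] C_def[symmetric] z_def[symmetric]
      using nz by (simp add: divide_simps) algebra
  qed
  moreover have "(\<lambda>n. G_term x n + G_term (x * p) n) sums (suminf (G_term x) + suminf (G_term (x * p)))"
    by (intro sums_add summable_sums summable_G_term x norm_xp)
  ultimately show ?thesis using sums_unique2 by (fastforce simp: T_def qpoch_Suc)
qed

lemma P_step: "(1 - x) * suminf (P_term x) = 1 + x * suminf (P_term (x * p))"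
proof -
  have sh: "P_term (x * p) m = p ^ m * P_term x m" for m
    by (induction m) (simp_all add: P_term_def mult_ac)
  have "(\<lambda>m. P_term x (Suc m)) sums (suminf (P_term x) - P_term x 0)"
    using summable_sums[OF summable_P_term[OF x]] by (simp add: sums_Suc_iff)
  moreover have "(\<lambda>m. x * P_term x m + x * P_term (x * p) m) sums (x * suminf (P_term x) + x * suminf (P_term (x * p)))"
    by (intro sums_add sums_mult summable_sums summable_P_term x norm_xp)
  moreover have "P_term x (Suc m) = x * P_term x m + x * P_term (x * p) m" for m
    unfolding P_term_Suc sh by (simp add: algebra_simps)
  ultimately have "suminf (P_term x) - P_term x 0 = x * suminf (P_term x) + x * suminf (P_term (x * p))"
    by (simp only: sums_unique2)
  then show ?thesis by (simp add: P_term_def algebra_simps)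
qed

lemma partial_theta_step: "suminf (partial_theta_term x) = 1 + x * suminf (partial_theta_term (x * p))"
proof -
  have "partial_theta_term x (Suc m) = x * partial_theta_term (x * p) m" for m
    unfolding partial_theta_term_def prod.lessThan_Suc_shift by (simp add: mult_ac)
  then have "(\<lambda>m. partial_theta_term x (Suc m)) sums (x * suminf (partial_theta_term (x * p)))"
    by (simp add: sums_mult summable_sums summable_partial_theta_term norm_xp)
  then have "partial_theta_term x sums (x * suminf (partial_theta_term (x * p)) + partial_theta_term x 0)"
    by (simp only: sums_Suc_iff)
  moreover have "partial_theta_term x 0 = 1" by (simp add: partial_theta_term_def)
  ultimately show ?thesis by (simp add: sums_iff)
qed

text \<open>Adding the terms at \<open>x\<close> and \<open>x * p\<close> cancels the denominator
  \<open>1 + p ^ m\<close> and leaves a geometric series.\<close>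

lemma Lambert_step: "suminf (Lambert_term x) + suminf (Lambert_term (x * p)) = 1 / (1 - x)"
proof -
  have "(\<lambda>m. Lambert_term x m + Lambert_term (x * p) m) sums (suminf (Lambert_term x) + suminf (Lambert_term (x * p)))"
    by (intro sums_add summable_sums summable_Lambert_term x norm_xp)
  moreover have "Lambert_term x m + Lambert_term (x * p) m = x ^ m" for m
  proof -
    have "1 + p ^ m \<noteq> 0" using one_plus_power_Suc_nonzero[of "m - 1"] by (cases m) auto
    moreover have "Lambert_term x m + Lambert_term (x * p) m = x ^ m * (1 + p ^ m) / (1 + p ^ m)"
      by (simp add: Lambert_term_def power_mult_distrib add_divide_distrib[symmetric] algebra_simps)
    ultimately show ?thesis by simp
  qed
  moreover have "(\<lambda>m. x ^ m) sums (1 / (1 - x))"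
    using x by (rule geometric_sums)
  ultimately show ?thesis by (simp only: sums_unique2)
qed

text \<open>Adding the series at \<open>x\<close> and \<open>x * p\<close> multiplies the term
  \<open>m\<close> by \<open>1 + p ^ m\<close>, which cancels its last denominator; the constant 2
  comes from the two initial terms.\<close>

lemma Phi_step: "suminf (Phi_term x) = 2 - (1 - x) * suminf (Phi_term (x * p))"
proof -
  have sh: "Phi_term (x * p) m = p ^ m * Phi_term x m" for m
    by (induction m) (simp_all add: Phi_term_def mult_ac)
  have s: "Phi_term y sums suminf (Phi_term y)" if "norm y < 1" for y
    by (rule summable_sums[OF summable_Phi_term[OF that]])
  have "(\<lambda>m. Phi_term x (Suc m) + Phi_term (x * p) (Suc m))
      sums (suminf (Phi_term x) - Phi_term x 0 + (suminf (Phi_term (x * p)) - Phi_term (x * p) 0))"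
    using s[OF x] s[OF norm_xp] by (intro sums_add) (simp_all add: sums_Suc_iff)
  moreover have "(\<lambda>m. x * Phi_term (x * p) m) sums (x * suminf (Phi_term (x * p)))"
    by (intro sums_mult s norm_xp)
  moreover have "Phi_term x (Suc m) + Phi_term (x * p) (Suc m) = x * Phi_term (x * p) m" for m
  proof -
    have "Phi_term x (Suc m) + Phi_term (x * p) (Suc m) = (1 + p ^ Suc m) * Phi_term x (Suc m)"
      unfolding sh by (simp add: algebra_simps)
    also have "\<dots> = x * p ^ m * Phi_term x m"
      unfolding Phi_term_Suc using one_plus_power_Suc_nonzero[of m] by simp
    finally show ?thesis by (simp add: sh)
  qed
  ultimately have "suminf (Phi_term x) - Phi_term x 0 + (suminf (Phi_term (x * p)) - Phi_term (x * p) 0)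
      = x * suminf (Phi_term (x * p))"
    by (simp only: sums_unique2)
  then show ?thesis by (simp add: Phi_term_def algebra_simps)
qed

end

text \<open>Subtracting \<open>E_step\<close> from \<open>P_step\<close> leaves the inhomogeneity
  \<open>1 / (qpoch_inf (- p) p * qpoch_inf (x * p) p)\<close>. Clearing the products turns it into
  the constant 1 of \<open>partial_theta_step\<close>, so the defect satisfies
  \<open>\<delta> y = y * \<delta> (y * p)\<close>.\<close>

lemma P_minus_E:
  assumes x: "norm x < 1"
  shows "suminf (P_term x) - suminf (E_term x)
    = suminf (partial_theta_term x) / (qpoch_inf (- p) p * qpoch_inf x p)"
proof -
  define \<delta> where "\<delta> y = qpoch_inf y p * qpoch_inf (- p) p * (suminf (P_term y) - suminf (E_term y))
    - suminf (partial_theta_term y)" for y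
  have xn: "norm (x * p ^ n) < 1" for n
    using power_norm_le[OF p, of x n] x by linarith
  have step: "\<delta> y = y * \<delta> (y * p)" if y: "norm y < 1" for y
  proof -
    define A B where "A = qpoch_inf (y * p) p" and "B = qpoch_inf (- p) p"
    have nz: "A \<noteq> 0" "B \<noteq> 0" using denominators_nonzero[OF norm_xp[OF y]] by (auto simp: A_def B_def)
    have 1: "qpoch_inf y p = (1 - y) * A" unfolding A_def by (rule qpoch_inf_step[OF p])
    have "(1 - y) * (suminf (P_term y) - suminf (E_term y))
        = y * (suminf (P_term (y * p)) - suminf (E_term (y * p))) + 1 / (B * A)"
    proof -
      define I where "I = 1 / (B * A)"
      have "(1 - y) * suminf (E_term y) - y * suminf (E_term (y * p)) = 1 - I"
        using E_step[OF y] by (simp add: I_def A_def B_def)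
      with P_step[OF y] show ?thesis unfolding I_def[symmetric] by algebra
    qed
    then have "A * B * ((1 - y) * (suminf (P_term y) - suminf (E_term y)))
        = y * (A * B * (suminf (P_term (y * p)) - suminf (E_term (y * p)))) + 1"
      using nz by (simp add: field_simps)
    then show ?thesis
      unfolding \<delta>_def 1 A_def[symmetric] B_def[symmetric] partial_theta_step[OF y] by algebra
  qed
  have "\<delta> (x * p ^ 0) = 0"
  proof (rule contracting_convergent_zero)
    show "norm (\<delta> (x * p ^ n)) \<le> norm x * norm (\<delta> (x * p ^ Suc n))" for n
    proof -
      have "\<delta> (x * p ^ n) = x * p ^ n * \<delta> (x * p ^ Suc n)"
        using step[OF xn[of n]] by (simp add: mult_ac)
      then show ?thesis
        using mult_right_mono[OF power_norm_le[OF p, of x n], of "norm (\<delta> (x * p ^ Suc n))"]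
        by (simp only: norm_mult norm_ge_zero)
    qed
    show "(\<lambda>n. \<delta> (x * p ^ n)) \<longlonglongrightarrow> 1 * qpoch_inf (- p) p * (suminf (P_term 0) - suminf (E_term 0))
        - suminf (partial_theta_term 0)"
      unfolding \<delta>_def
      by (intro tendsto_intros qpoch_inf_tendsto_1 p x P_tendsto E_tendsto partial_theta_tendsto)
  qed (use x in auto)
  then show ?thesis using denominators_nonzero[OF x] by (simp add: \<delta>_def field_simps)
qed

text \<open>The two inhomogeneities of \<open>G_step\<close> are matched separately:
  \<open>1 / (1 - y)\<close> by the Lambert series, the product term by \<open>Phi_step\<close>
  divided by \<open>qpoch_inf y p\<close>. The defect then changes sign under
  \<open>y \<mapsto> y p\<close>.\<close>

lemma G_eq_Lambert_Phi:
  assumes x: "norm x < 1"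
  shows "suminf (G_term x) = suminf (Lambert_term x)
    - qpoch_inf p p / (2 * qpoch_inf (- p) p * qpoch_inf x p) * suminf (Phi_term x)"
proof -
  define K where "K = qpoch_inf p p / (2 * qpoch_inf (- p) p)"
  define \<delta> where "\<delta> y = suminf (G_term y) - suminf (Lambert_term y) + K * (suminf (Phi_term y) / qpoch_inf y p)" for y
  have xn: "norm (x * p ^ n) < 1" for n
    using power_norm_le[OF p, of x n] x by linarith
  have step: "\<delta> y = - \<delta> (y * p)" if y: "norm y < 1" for y
  proof -
    have 1: "qpoch_inf y p = (1 - y) * qpoch_inf (y * p) p" by (rule qpoch_inf_step[OF p])
    have "suminf (Phi_term y) / qpoch_inf y p = 2 / qpoch_inf y p - suminf (Phi_term (y * p)) / qpoch_inf (y * p) p"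
      unfolding Phi_step[OF y] diff_divide_distrib using denominators_nonzero[OF y] by (simp add: 1)
    moreover have "suminf (G_term y) + suminf (G_term (y * p)) = 1 / (1 - y) - K * (2 / qpoch_inf y p)"
      using G_step[OF y] by (simp add: K_def)
    ultimately show ?thesis
      using Lambert_step[OF y] unfolding \<delta>_def by algebra
  qed
  have "\<delta> (x * p ^ 0) = 0"
  proof (rule alternating_convergent_zero)
    show "\<delta> (x * p ^ n) = - \<delta> (x * p ^ Suc n)" for n
      using step[OF xn[of n]] by (simp add: mult_ac)
    show "(\<lambda>n. \<delta> (x * p ^ n)) \<longlonglongrightarrow> suminf (G_term 0) - suminf (Lambert_term 0) + K * (suminf (Phi_term 0) / 1)"
      unfolding \<delta>_def
      by (intro tendsto_intros qpoch_inf_tendsto_1 p x G_tendsto Lambert_tendsto Phi_tendsto) auto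
  qed
  then show ?thesis by (simp add: \<delta>_def K_def field_simps)
qed

end

subsection \<open>The third order mock theta function\<close>

context
  fixes q :: complex
  assumes q: "norm q < 1"
begin

text \<open>A deformation of the summand of \<open>mock_theta_f3\<close>, which is the case
  \<open>t = - 1\<close>.\<close>

definition R_term :: "complex \<Rightarrow> nat \<Rightarrow> complex" where
  "R_term t n = (- t) ^ n * q ^ (n\<^sup>2) / (qpoch (- q) q n * qpoch (t * q) q n)"

definition F_term :: "complex \<Rightarrow> nat \<Rightarrow> complex" where
  "F_term t n = t ^ n / qpoch (- q) q n"

lemma R_term_Suc:
  "R_term t (Suc n) = - (t * (q ^ n * q ^ Suc n)) / ((1 + q ^ Suc n) * (1 - t * q ^ Suc n)) * R_term t n"
proof -
  have "(Suc n)\<^sup>2 = n\<^sup>2 + n + Suc n" by (simp add: power2_eq_square)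
  then have "q ^ ((Suc n)\<^sup>2) = q ^ (n\<^sup>2) * (q ^ n * q ^ Suc n)" by (simp add: power_add mult_ac)
  then show ?thesis unfolding R_term_def by (simp add: qpoch_Suc mult_ac)
qed

lemma F_term_Suc: "F_term t (Suc n) = t / (1 + q ^ Suc n) * F_term t n"
  by (simp add: F_term_def qpoch_Suc mult_ac)

lemma one_plus_nonzero: "1 + q ^ Suc n \<noteq> 0"
  using one_plus_power_Suc_nonzero[OF q] .

lemmas qpower_limits = power_limits[OF q]

lemma summable_R_term: "summable (R_term t)"
proof (rule summable_ratio_limit)
  show "(\<lambda>n. norm (- (t * (q ^ n * q ^ Suc n)) / ((1 + q ^ Suc n) * (1 - t * q ^ Suc n))))
      \<longlonglongrightarrow> norm (- (t * (0 * 0)) / ((1 + 0) * (1 - 0)))"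
    by (intro qpower_limits) auto
qed (simp_all only: R_term_Suc norm_mult, simp_all)

lemma summable_F_term:
  assumes "norm t < 1" shows "summable (F_term t)"
proof (rule summable_ratio_limit)
  show "(\<lambda>n. norm (t / (1 + q ^ Suc n))) \<longlonglongrightarrow> norm (t / (1 + 0))"
    by (intro qpower_limits) auto
qed (use assms in \<open>simp_all only: F_term_Suc norm_mult, simp_all\<close>)

lemma R_step:
  assumes t: "norm (t * q) < 1"
  shows "suminf (R_term t) = 2 - suminf (R_term (t * q)) / (1 - t * q)"
proof -
  define V where "V n = (1 + q ^ n) * R_term t n" for n
  have "V \<longlonglongrightarrow> (1 + 0) * 0"
    unfolding V_def by (intro qpower_limits summable_LIMSEQ_zero summable_R_term)
  then have "(\<lambda>n. V n - V (Suc n)) sums (V 0 - (1 + 0) * 0)"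
    by (rule telescope_sums')
  moreover have "V n - V (Suc n) = R_term t n + R_term (t * q) n / (1 - t * q)" for n
  proof -
    define z where "z = t * q ^ Suc n"
    have nz: "1 + q ^ Suc n \<noteq> 0" "1 - z \<noteq> 0" "1 - t * q \<noteq> 0"
      using one_plus_nonzero qpoch_factor_nonzero[OF q t, of n] one_minus_nonzero[OF t]
      by (auto simp: z_def mult_ac)
    have "qpoch (t * q * q) q n = qpoch (t * q) q n * (1 - z) / (1 - t * q)"
      using qpoch_shift[of "t * q" q n] nz by (simp add: field_simps z_def)
    moreover have "(- (t * q)) ^ n = (- t) ^ n * q ^ n"
      by (metis mult_minus_left power_mult_distrib)
    ultimately have 1: "R_term (t * q) n / (1 - t * q) = q ^ n / (1 - z) * R_term t n"
      unfolding R_term_def using nz by (simp add: mult_ac)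
    have "V (Suc n) = - (q ^ n * z) / (1 - z) * R_term t n"
      unfolding V_def R_term_Suc z_def[symmetric] using nz by (simp add: z_def mult_ac)
    then show ?thesis unfolding 1 using nz by (simp add: V_def field_simps)
  qed
  moreover have "(\<lambda>n. R_term t n + R_term (t * q) n / (1 - t * q))
      sums (suminf (R_term t) + suminf (R_term (t * q)) / (1 - t * q))"
    by (intro sums_add sums_divide summable_sums summable_R_term)
  ultimately have "V 0 - (1 + 0) * 0 = suminf (R_term t) + suminf (R_term (t * q)) / (1 - t * q)"
    by (simp only: sums_unique2)
  then show ?thesis by (simp add: V_def R_term_def algebra_simps)
qed

lemma F_step:
  assumes t: "norm t < 1"
  shows "(1 - t) * suminf (F_term t) = 2 - suminf (F_term (t * q))"
proof -
  have sh: "F_term (t * q) n = q ^ n * F_term t n" for n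
    by (simp add: F_term_def power_mult_distrib)
  have s: "F_term y sums suminf (F_term y)" if "norm y < 1" for y
    by (rule summable_sums[OF summable_F_term[OF that]])
  note tq = norm_xp[OF q t]
  have "(\<lambda>n. F_term t (Suc n) + F_term (t * q) (Suc n))
      sums (suminf (F_term t) - F_term t 0 + (suminf (F_term (t * q)) - F_term (t * q) 0))"
    using s[OF t] s[OF tq] by (intro sums_add) (simp_all add: sums_Suc_iff)
  moreover have "(\<lambda>n. t * F_term t n) sums (t * suminf (F_term t))"
    by (intro sums_mult s t)
  moreover have "F_term t (Suc n) + F_term (t * q) (Suc n) = t * F_term t n" for n
  proof -
    have "F_term t (Suc n) + F_term (t * q) (Suc n) = (1 + q ^ Suc n) * F_term t (Suc n)"
      unfolding sh by (simp add: algebra_simps)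
    also have "\<dots> = t * F_term t n"
      unfolding F_term_Suc using one_plus_nonzero[of n] by simp
    finally show ?thesis .
  qed
  ultimately have "suminf (F_term t) - F_term t 0 + (suminf (F_term (t * q)) - F_term (t * q) 0) = t * suminf (F_term t)"
    by (simp only: sums_unique2)
  then show ?thesis by (simp add: F_term_def algebra_simps)
qed

lemma R_tendsto:
  assumes t: "norm t < 1"
  shows "(\<lambda>n. suminf (R_term (t * q ^ n))) \<longlonglongrightarrow> suminf (R_term 0)"
proof (rule tannery_ratio)
  show "(\<lambda>n. - (t * q ^ n * (q ^ k * q ^ Suc k)) / ((1 + q ^ Suc k) * (1 - t * q ^ n * q ^ Suc k)))
      \<longlonglongrightarrow> - (0 * (q ^ k * q ^ Suc k)) / ((1 + q ^ Suc k) * (1 - 0 * q ^ Suc k))" for k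
    using one_plus_nonzero[of k] by (intro qpower_limits) auto
  show "norm (- (t * q ^ n * (q ^ k * q ^ Suc k)) / ((1 + q ^ Suc k) * (1 - t * q ^ n * q ^ Suc k)))
      \<le> norm (t * (q ^ k * q ^ Suc k) / (1 + q ^ Suc k)) / (1 - norm (t * q ^ Suc k))" for n k
  \<comment> \<open>The denominator is bounded with \<open>q ^ n\<close> kept in the numerator; the
    second estimate then drops \<open>q ^ n\<close>.\<close>
  proof -
    have "norm (t * (q ^ k * q ^ Suc k) / (1 + q ^ Suc k) * q ^ n / (1 - t * q ^ n * q ^ Suc k))
      \<le> norm (t * (q ^ k * q ^ Suc k) / (1 + q ^ Suc k) * q ^ n) / (1 - norm (t * q ^ Suc k))"
      by (rule norm_factor_bound[OF q t])
    also have "\<dots> \<le> norm (t * (q ^ k * q ^ Suc k) / (1 + q ^ Suc k)) / (1 - norm (t * q ^ Suc k))"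
      using power_norm_le[OF q, of t "Suc k"] t by (intro divide_right_mono power_norm_le q) linarith
    finally show ?thesis by (simp add: mult_ac)
  qed
  show "(\<lambda>k. norm (t * (q ^ k * q ^ Suc k) / (1 + q ^ Suc k)) / (1 - norm (t * q ^ Suc k)))
      \<longlonglongrightarrow> norm (t * (0 * 0) / (1 + 0)) / (1 - norm (0::complex))"
    by (intro qpower_limits) auto
qed (simp_all only: R_term_Suc, simp_all add: R_term_def)

lemma F_tendsto:
  assumes t: "norm t < 1"
  shows "(\<lambda>n. suminf (F_term (t * q ^ n))) \<longlonglongrightarrow> suminf (F_term 0)"
proof (rule tannery_ratio)
  show "(\<lambda>n. t * q ^ n / (1 + q ^ Suc k)) \<longlonglongrightarrow> 0 / (1 + q ^ Suc k)" for k
    using one_plus_nonzero[of k] by (intro qpower_limits) auto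
  show "norm (t * q ^ n / (1 + q ^ Suc k)) \<le> norm (t / (1 + q ^ Suc k))" for n k
    using power_norm_le[OF q, of "t / (1 + q ^ Suc k)" n] by (simp add: mult_ac)
  show "(\<lambda>k. norm (t / (1 + q ^ Suc k))) \<longlonglongrightarrow> norm (t / (1 + 0))"
    by (intro qpower_limits) auto
qed (use t in \<open>simp_all only: F_term_Suc, simp_all add: F_term_def\<close>)

text \<open>
  The value needed is at \<open>t = - 1\<close>, where \<open>F\<close> diverges; it is reached from \<open>t = - q\<close> by one application of \<open>R_step\<close>.
\<close>

lemma R_eq_F:
  assumes t: "norm t < 1"
  shows "suminf (R_term t) = (1 - t) * suminf (F_term t)"
proof -
  \<comment> \<open>The factor \<open>qpoch_inf y q\<close> turns the common functional equation into \<open>\<delta> y = - \<delta> (y q)\<close>.\<close>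
  define \<delta> where "\<delta> y = qpoch_inf y q * (suminf (R_term y) / (1 - y) - suminf (F_term y))" for y
  have tn: "norm (t * q ^ n) < 1" for n
    using power_norm_le[OF q, of t n] t by linarith
  have step: "\<delta> y = - \<delta> (y * q)" if y: "norm y < 1" for y
  proof -
    have nz: "1 - y \<noteq> 0" using one_minus_nonzero[OF y] by simp
    have "\<delta> y = qpoch_inf (y * q) q * (suminf (R_term y) - (1 - y) * suminf (F_term y))"
      unfolding \<delta>_def qpoch_inf_step[OF q, of y] using nz by (simp add: field_simps)
    also have "\<dots> = - \<delta> (y * q)"
      unfolding F_step[OF y] R_step[OF norm_xp[OF q y]] by (simp add: \<delta>_def algebra_simps)
    finally show ?thesis .
  qed
  have "\<delta> (t * q ^ 0) = 0"
  proof (rule alternating_convergent_zero)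
    show "\<delta> (t * q ^ n) = - \<delta> (t * q ^ Suc n)" for n
      using step[OF tn[of n]] by (simp add: mult_ac)
    show "(\<lambda>n. \<delta> (t * q ^ n)) \<longlonglongrightarrow> 1 * (suminf (R_term 0) / (1 - 0) - suminf (F_term 0))"
      unfolding \<delta>_def
      by (intro qpower_limits qpoch_inf_tendsto_1 q t R_tendsto F_tendsto) auto
  qed
  then have "suminf (R_term t) / (1 - t) - suminf (F_term t) = 0"
    using qpoch_inf_nonzero[OF q t] by (simp add: \<delta>_def)
  then show ?thesis
    using one_minus_nonzero[OF t] by (simp add: field_simps)
qed

lemma mock_theta_f3_eq: "mock_theta_f3 q = 2 - suminf (F_term (- q))"
proof -
  have "mock_theta_f3 q = suminf (R_term (- 1))"
    unfolding mock_theta_f3_def R_term_def by (simp add: power2_eq_square)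
  also have "\<dots> = 2 - suminf (F_term (- q))"
    using R_step[of "- 1"] R_eq_F[of "- q"] one_minus_nonzero[OF q] q by simp
  finally show ?thesis .
qed

text \<open>With \<open>k n = 1 / qpoch (- q) q n\<close> the terms of \<open>F\<close> after the
  first are signed differences \<open>k n - k (Suc n)\<close>. Pairing the terms
  \<open>2 * n + 1\<close> and \<open>2 * n + 2\<close> gives twice a term of \<open>E\<close> minus
  a telescoping difference of the values \<open>k (2 * n)\<close>.\<close>

lemma F_eq_E: "suminf (F_term (- q)) = 1 / qpoch_inf (- q) q + 2 * suminf (E_term (q\<^sup>2) (- q))"
proof -
  define k where "k n = 1 / qpoch (- q) q n" for n
  have nz: "qpoch (- q) q n \<noteq> 0" for n using qpoch_nonzero[OF q, of "- q"] q by simp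
  have kq: "q ^ Suc n * k (Suc n) = k n - k (Suc n)" for n
  proof -
    have "k n = (1 + q ^ Suc n) * k (Suc n)"
      using one_plus_nonzero[of n] by (simp add: k_def qpoch_Suc)
    then show ?thesis by (simp add: algebra_simps)
  qed
  have F: "F_term (- q) (Suc n) = (- 1) ^ Suc n * (k n - k (Suc n))" for n
    unfolding kq[symmetric] by (simp add: F_term_def k_def power_minus[of q])
  have E: "E_term (q\<^sup>2) (- q) n = k (Suc (2 * n)) - k (2 * Suc n)" for n
  proof -
    have "E_term (q\<^sup>2) (- q) n = q ^ (2 * Suc n) * k (2 * Suc n)"
      unfolding E_term_def[OF norm_square_less_1[OF q]] k_def qpoch_split power_mult
      by (simp add: power2_eq_square mult_ac)
    then show ?thesis using kq[of "Suc (2 * n)"] by simp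
  qed
  have "(\<lambda>n. F_term (- q) (Suc n)) sums (suminf (F_term (- q)) - 1)"
    using summable_sums[OF summable_F_term[of "- q"]] q by (simp add: sums_Suc_iff F_term_def[of _ 0])
  moreover have "(\<Sum>j\<in>{n * 2..<n * 2 + 2}. F_term (- q) (Suc j))
      = 2 * E_term (q\<^sup>2) (- q) n - (k (2 * n) - k (2 * Suc n))" for n
  proof -
    have "{n * 2..<n * 2 + 2} = {2 * n, Suc (2 * n)}" by auto
    then show ?thesis by (simp add: F E algebra_simps)
  qed
  ultimately  have "(\<lambda>n. 2 * E_term (q\<^sup>2) (- q) n - (k (2 * n) - k (2 * Suc n))) sums (suminf (F_term (- q)) - 1)"
    using sums_group[of "\<lambda>n. F_term (- q) (Suc n)" _ 2] by fastforce
  moreover have "(\<lambda>n. 2 * E_term (q\<^sup>2) (- q) n - (k (2 * n) - k (2 * Suc n)))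
      sums (2 * suminf (E_term (q\<^sup>2) (- q)) - (k (2 * 0) - 1 / qpoch_inf (- q) q))"
  proof -
    have "k \<longlonglongrightarrow> 1 / qpoch_inf (- q) q"
      unfolding k_def using qpoch_inf_nonzero[OF q, of "- q"] q by (intro tendsto_intros qpoch_tendsto q) auto
    from LIMSEQ_subseq_LIMSEQ[OF this, of "\<lambda>n. 2 * n"]
    have "(\<lambda>n. k (2 * n)) \<longlonglongrightarrow> 1 / qpoch_inf (- q) q" by (simp add: o_def strict_mono_def)
    from telescope_sums'[OF this] show ?thesis
      using q by (intro sums_diff[of "\<lambda>n. 2 * E_term (q\<^sup>2) (- q) n"] sums_mult summable_sums
        summable_E_term norm_square_less_1) simp_all
  qed
  ultimately have "suminf (F_term (- q)) - 1 = 2 * suminf (E_term (q\<^sup>2) (- q)) - (k (2 * 0) - 1 / qpoch_inf (- q) q)"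
    by (rule sums_unique2)
  then show ?thesis by (simp add: k_def)
qed

text \<open>With \<open>n = Suc m\<close> and \<open>N = 2 * n\<close>, the symbol with
  \<open>n + 1\<close> factors is the tail of \<open>qpoch (q\<^sup>2) (q\<^sup>2) N = qpoch q q N *
  qpoch (- q) q N\<close> after its first \<open>m\<close> factors, and \<open>qpoch q q N\<close>
  completes the infinite symbol to \<open>qpoch_inf q q\<close>.\<close>

lemma series_term_eq:
  "q ^ (2 * Suc m) / (qpoch (q ^ (2 * Suc m)) (q\<^sup>2) (Suc m + 1) * qpoch_inf (q ^ (2 * Suc m + 1)) q)
    = G_term (q\<^sup>2) (- q) m / qpoch_inf q q"
proof -
  define A N where "A = qpoch (q\<^sup>2) (q\<^sup>2) m" and "N = 2 * Suc m"
  have p: "norm (q\<^sup>2) < 1" by (rule norm_square_less_1[OF q])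
  have A: "A \<noteq> 0" unfolding A_def by (rule qpoch_nonzero[OF p p])
  have "m + (Suc m + 1) = N" by (simp add: N_def)
  moreover have "q\<^sup>2 * (q\<^sup>2) ^ m = q ^ N" unfolding N_def power_mult by simp
  ultimately have "qpoch (q\<^sup>2) (q\<^sup>2) N = A * qpoch (q ^ N) (q\<^sup>2) (Suc m + 1)"
    using qpoch_add[of "q\<^sup>2" "q\<^sup>2" m "Suc m + 1"] unfolding A_def by simp
  then have 1: "qpoch (q ^ N) (q\<^sup>2) (Suc m + 1) = qpoch q q N * qpoch (- q) q N / A"
    using A by (simp add: qpoch_square)
  have 2: "qpoch_inf q q = qpoch q q N * qpoch_inf (q ^ (N + 1)) q"
    using qpoch_inf_add[OF q, of q N] by simp
  have 3: "qpoch (- q) q N = qpoch (- q\<^sup>2) (q\<^sup>2) (Suc m) * qpoch (- q) (q\<^sup>2) (Suc m)"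
    unfolding N_def qpoch_split by (simp add: power2_eq_square mult.commute)
  have 4: "q ^ N = (q\<^sup>2) ^ Suc m" unfolding N_def by (rule power_mult)
  show ?thesis
    unfolding N_def[symmetric] 1 unfolding 2 3 G_term_def[OF p] A_def[symmetric] unfolding 4
    by (simp add: mult_ac)
qed

end

section \<open>Product evaluations at base \<open>q\<^sup>2\<close> and argument
  \<open>z = q\<close>\<close>

context
  fixes q :: complex
  assumes q: "norm q < 1" and q0: "q \<noteq> 0"
begin

lemma norm_p: "norm (q\<^sup>2) < 1" and norm_p_q: "norm (q\<^sup>2) < norm q" and norm_minus: "norm (- q) < 1"
  using norm_square_less_1[OF q] q q0 by (auto simp: norm_power power2_eq_square norm_mult)

lemma minus_one_times_power: "- 1 * (q\<^sup>2) ^ Suc k \<noteq> 1"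
proof
  assume "- 1 * (q\<^sup>2) ^ Suc k = 1"
  then have "1 + (q\<^sup>2) ^ Suc k = 0" by (metis add.left_inverse mult_minus1)
  then show False using one_plus_power_Suc_nonzero[OF norm_p] by blast
qed

text \<open>Jacobi's triple product: for \<open>\<alpha> = b = 0\<close> both halves of
  \<open>psi\<close> are the same partial theta series, and together they form the sum of
  \<open>(- 1) ^ n * q ^ (n\<^sup>2)\<close> over all integers.\<close>

lemma theta_product:
  "2 * suminf (partial_theta_term (q\<^sup>2) (- q)) - 1 = (qpoch_inf q (q\<^sup>2))\<^sup>2 * qpoch_inf (q\<^sup>2) (q\<^sup>2)"
proof -
  have "psi_pos (q\<^sup>2) 0 0 q = partial_theta_term (q\<^sup>2) (- q)"
    unfolding psi_pos_def partial_theta_term_def[OF norm_p] by (auto simp: mult.commute)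
  moreover have "psi_neg (q\<^sup>2) 0 0 q = partial_theta_term (q\<^sup>2) (- q)"
    unfolding psi_neg_def partial_theta_term_def[OF norm_p] using q0
    by (auto simp: power2_eq_square intro!: prod.cong)
  ultimately show ?thesis
    using psi_0[OF norm_p q0, of 0, OF _ _ norm_p_q] q0
    by (simp add: psi_def power2_eq_square mult_ac)
qed

text \<open>Both use \<open>\<alpha> = - 1\<close>. For \<open>b = 0\<close> the halves of
  \<open>psi\<close> are \<open>P\<close> and \<open>\<Phi>\<close>; for
  \<open>b = - (q\<^sup>2)\<close> each half is twice the Lambert series, and
  \<open>psi_eq_psi_0\<close> links the two values.\<close>

lemma Phi_P_product:
  "qpoch_inf (- q) (q\<^sup>2) * qpoch_inf (- (q\<^sup>2)) (q\<^sup>2) *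
    (suminf (P_term (q\<^sup>2) (- q)) + suminf (Phi_term (q\<^sup>2) (- q)) - 1)
    = (qpoch_inf q (q\<^sup>2))\<^sup>2 * qpoch_inf (q\<^sup>2) (q\<^sup>2)"
  and Lambert_product:
  "qpoch_inf (- q) (q\<^sup>2) * qpoch_inf (- (q\<^sup>2)) (q\<^sup>2) * (4 * suminf (Lambert_term (q\<^sup>2) (- q)) - 1)
    = qpoch_inf (q\<^sup>2) (q\<^sup>2) * (suminf (P_term (q\<^sup>2) (- q)) + suminf (Phi_term (q\<^sup>2) (- q)) - 1)"
proof -
  note nz = one_plus_power_Suc_nonzero[OF norm_p]
  have "psi_pos (q\<^sup>2) (- 1) 0 q = P_term (q\<^sup>2) (- q)"
    unfolding psi_pos_def P_term_def[OF norm_p] by (auto intro!: prod.cong simp: algebra_simps)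
  moreover have "psi_neg (q\<^sup>2) (- 1) 0 q = Phi_term (q\<^sup>2) (- q)"
    unfolding psi_neg_def Phi_term_def[OF norm_p]
  proof (intro ext prod.cong refl)
    fix k
    show "((q\<^sup>2) ^ Suc k - 0) / ((- 1 * (q\<^sup>2) ^ Suc k - 1) * q) = - q * (q\<^sup>2) ^ k / (1 + (q\<^sup>2) ^ Suc k)"
      using nz[of k] minus_one_times_power[of k] q0 by (simp add: divide_simps) (simp add: algebra_simps power2_eq_square)
  qed
  ultimately have 0: "psi (q\<^sup>2) (- 1) 0 q = suminf (P_term (q\<^sup>2) (- q)) + suminf (Phi_term (q\<^sup>2) (- q)) - 1"
    by (simp add: psi_def)
  then show "qpoch_inf (- q) (q\<^sup>2) * qpoch_inf (- (q\<^sup>2)) (q\<^sup>2) *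
    (suminf (P_term (q\<^sup>2) (- q)) + suminf (Phi_term (q\<^sup>2) (- q)) - 1)
    = (qpoch_inf q (q\<^sup>2))\<^sup>2 * qpoch_inf (q\<^sup>2) (q\<^sup>2)"
    using psi_0[OF norm_p q0, of "- 1", OF _ minus_one_times_power norm_p_q] q q0
    by (simp add: power2_eq_square mult_ac)
  \<comment> \<open>The quotients telescope to \<open>2 / (1 + (q\<^sup>2) ^ m)\<close>, the 2 being
    \<open>1 + (q\<^sup>2) ^ 0\<close>.\<close>
  have L: "(\<Prod>k<m. - q * (1 + (q\<^sup>2) ^ k) / (1 + (q\<^sup>2) ^ Suc k)) = 2 * Lambert_term (q\<^sup>2) (- q) m" for m
  proof (induction m)
    case (Suc m)
    then show ?case by (simp add: Lambert_term_Suc[OF norm_p])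
  qed (simp add: Lambert_term_def[OF norm_p])
  have "psi_pos (q\<^sup>2) (- 1) (- (q\<^sup>2)) q = (\<lambda>m. 2 * Lambert_term (q\<^sup>2) (- q) m)"
    unfolding psi_pos_def L[symmetric] by (auto intro!: prod.cong simp: algebra_simps)
  moreover have "psi_neg (q\<^sup>2) (- 1) (- (q\<^sup>2)) q = (\<lambda>m. 2 * Lambert_term (q\<^sup>2) (- q) m)"
    unfolding psi_neg_def L[symmetric]
  proof (intro ext prod.cong refl)
    fix k
    show "((q\<^sup>2) ^ Suc k - - (q\<^sup>2)) / ((- 1 * (q\<^sup>2) ^ Suc k - 1) * q) = - q * (1 + (q\<^sup>2) ^ k) / (1 + (q\<^sup>2) ^ Suc k)"
      using nz[of k] minus_one_times_power[of k] q0 by (simp add: divide_simps) (simp add: algebra_simps power2_eq_square)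
  qed
  ultimately have "psi (q\<^sup>2) (- 1) (- (q\<^sup>2)) q = 4 * suminf (Lambert_term (q\<^sup>2) (- q)) - 1"
    using suminf_mult[OF summable_Lambert_term[OF norm_p norm_minus], of 2] by (simp add: psi_def)
  then show "qpoch_inf (- q) (q\<^sup>2) * qpoch_inf (- (q\<^sup>2)) (q\<^sup>2) * (4 * suminf (Lambert_term (q\<^sup>2) (- q)) - 1)
    = qpoch_inf (q\<^sup>2) (q\<^sup>2) * (suminf (P_term (q\<^sup>2) (- q)) + suminf (Phi_term (q\<^sup>2) (- q)) - 1)"
    using psi_eq_psi_0[OF norm_p q0, of "- 1" "- (q\<^sup>2)", OF _ minus_one_times_power] 0 norm_p norm_p_q q q0
    by (simp add: power2_eq_square mult_ac)
qed

end

theorem theorem1p1: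
  fixes q :: complex
  assumes "norm q < 1"
  shows "mock_theta_f3 q =
    1 / qpoch_inf q q
    - 4 * (\<Sum>m. let n = m + 1 in
        q ^ (2 * n) / (qpoch (q ^ (2 * n)) (q\<^sup>2) (n + 1) * qpoch_inf (q ^ (2 * n + 1)) q))"
proof (cases "q = 0")
  \<comment> \<open>The product evaluations divide by \<open>z = q\<close>, so this value is treated
    directly; the series on the right vanishes termwise.\<close>
  case True
  have "mock_theta_f3 0 = (\<Sum>n. if n = 0 then 1 else 0)"
    unfolding mock_theta_f3_def by (intro suminf_cong) auto
  also have "\<dots> = 1" using sums_single[of 0 "\<lambda>_. 1 :: complex"] by (simp add: sums_iff)
  finally show ?thesis using True by simp
next
  case False
  note q = assms
  define A B C D where "A = qpoch_inf q (q\<^sup>2)" and "B = qpoch_inf (q\<^sup>2) (q\<^sup>2)"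
    and "C = qpoch_inf (- q) (q\<^sup>2)" and "D = qpoch_inf (- (q\<^sup>2)) (q\<^sup>2)"
  note defs = A_def B_def C_def D_def
  note np = norm_p[OF q False] and nm = norm_minus[OF q False]
  have nz: "A \<noteq> 0" "B \<noteq> 0" "C \<noteq> 0" "D \<noteq> 0"
    using qpoch_inf_nonzero[OF np] np q nm unfolding defs by auto
  have AB: "qpoch_inf q q = A * B"
    using qpoch_inf_split[OF q, of q] by (simp add: defs power2_eq_square)
  have CD: "qpoch_inf (- q) q = C * D"
    using qpoch_inf_split[OF q, of "- q"] by (simp add: defs power2_eq_square)
  \<comment> \<open>Euler's identity: cancelling \<open>B\<close> shows that
    \<open>A = qpoch_inf q (q\<^sup>2)\<close> is the inverse of
    \<open>qpoch_inf (- q) q\<close>.\<close>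
  have "A * B * (C * D) = B"
    using qpoch_inf_square[OF q, of q] by (simp add: AB CD B_def)
  then have ACD: "A * C * D = 1" using nz by (simp add: mult_ac)
  define P E \<Theta> L \<Phi> G where "P = suminf (P_term (q\<^sup>2) (- q))" and "E = suminf (E_term (q\<^sup>2) (- q))"
    and "\<Theta> = suminf (partial_theta_term (q\<^sup>2) (- q))" and "L = suminf (Lambert_term (q\<^sup>2) (- q))"
    and "\<Phi> = suminf (Phi_term (q\<^sup>2) (- q))" and "G = suminf (G_term (q\<^sup>2) (- q))"
  note sums_defs = P_def E_def \<Theta>_def L_def \<Phi>_def G_def
  have inv: "1 / (C * D) = A" "1 / (D * C) = A" using ACD nz by (simp_all add: field_simps)
  have f3: "mock_theta_f3 q = 2 - A - 2 * E"
    unfolding mock_theta_f3_eq[OF q] F_eq_E[OF q] CD inv E_def by simp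
  have PE: "P - E = A * \<Theta>"
    using P_minus_E[OF np nm] inv unfolding sums_defs defs[symmetric] by (metis mult.commute times_divide_eq_right mult_1_right)
  have "G = L - B / (2 * D * C) * \<Phi>"
    using G_eq_Lambert_Phi[OF np nm] unfolding sums_defs defs .
  moreover have "B / (2 * D * C) = A * B / 2" using ACD nz by (simp add: field_simps)
  ultimately have G: "2 * G = 2 * L - A * B * \<Phi>" by simp
  have 1: "2 * \<Theta> - 1 = A\<^sup>2 * B"
    using theta_product[OF q False] by (simp only: sums_defs defs)
  have 2: "C * D * (P + \<Phi> - 1) = A\<^sup>2 * B"
    using Phi_P_product[OF q False] by (simp only: sums_defs defs)
  have 3: "C * D * (4 * L - 1) = B * (P + \<Phi> - 1)"
    using Lambert_product[OF q False] by (simp only: sums_defs defs)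
  have 4: "P + \<Phi> - 1 = A ^ 3 * B" using 2 ACD by algebra
  have 5: "4 * L - 1 = A * B * (P + \<Phi> - 1)" using 3 ACD by algebra
  \<comment> \<open>Both sides reduce to \<open>2 * A * B * \<Phi> - A ^ 4 * B\<^sup>2\<close>: the
    left one by eliminating \<open>E\<close>, \<open>\<Theta>\<close> and \<open>P\<close>, the
    right one by eliminating \<open>G\<close> and \<open>L\<close>.\<close>
  have "A * B * (2 - A - 2 * E) = 1 - 4 * G" using PE G 1 4 5 by algebra
  then have "2 - A - 2 * E = 1 / (A * B) - 4 * (G / (A * B))" using nz by (simp add: field_simps)
  moreover have "(\<Sum>m. let n = m + 1 in
        q ^ (2 * n) / (qpoch (q ^ (2 * n)) (q\<^sup>2) (n + 1) * qpoch_inf (q ^ (2 * n + 1)) q)) = G / (A * B)"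
  proof -
    have "(\<Sum>m. let n = m + 1 in
        q ^ (2 * n) / (qpoch (q ^ (2 * n)) (q\<^sup>2) (n + 1) * qpoch_inf (q ^ (2 * n + 1)) q))
        = (\<Sum>m. G_term (q\<^sup>2) (- q) m / qpoch_inf q q)"
      unfolding Let_def Suc_eq_plus1[symmetric, of "_ :: nat"] series_term_eq[OF q, unfolded Suc_eq_plus1[symmetric]] ..
    also have "\<dots> = G / (A * B)"
      unfolding G_def AB by (rule suminf_divide[OF summable_G_term[OF np nm]])
    finally show ?thesis .
  qed
  ultimately show ?thesis unfolding f3 AB by simp
qed

end
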